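(* Let $m,n\ge 1$ be integers. Let $f,g:[0,+\infty)\times\mathbb{R}^n\to\mathbb{R}^n$ be functions, let $A(t)=(a_{ij}(t))_{i,j=1}^m\in\mathbb{R}^{m\times m}$ for $t\in[0,+\infty)$, let $\tau_{ij}$ ($i,j=1,\ldots,m$) be real-valued functions on $[0,+\infty)$, and let $\mathrm{d}K_{ij}(s)$ ($i,j=1,\ldots,m$) be (signed) Lebesgue--Stieltjes measures on $[0,\infty)$ with $\int_0^\infty|\mathrm{d}K_{ij}(s)|<+\infty$. Consider the coupled system $$\dot{x}^i(t)=f(t,x^i(t))+\sum_{j=1}^{m}a_{ij}(t)\int_0^{\infty}g\big(t,x^j(t-\tau_{ij}(t)-s)\big)\,\mathrm{d}K_{ij}(s),\qquad i=1,\ldots,m,\qquad ( * )$$ where $x^i(t)\in\mathbb{R}^n$ and the dot denotes the right-hand derivative. Suppose that: (A1) $f(t,u)$ is continuous, and locally Lipschitz continuous with respect to $u$, i.e. for each compact subset $W$ of $[0,+\infty)\times\mathbb{R}^n$ there is a constant $l(W)>0$ such that $\|f(t,u_1)-f(t,u_2)\|\le l(W)\|u_1-u_2\|$ for all $(t,u_1),(t,u_2)\in W$; (A2) $A(t)=(a_{ij}(t))_{i,j=1}^m$ is continuous on $[0,+\infty)$; (A3) $g(t,u)$ is continuous, and there is a continuous function $\kappa:[0,+\infty)\to\mathbb{R}^+$ such that $\|g(t,u_1)-g(t,u_2)\|\le\kappa(t)\|u_1-u_2\|$ for all $t\in[0,+\infty)$ and $u_1,u_2\in\mathbb{R}^n$;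 (A4) for each $i,j=1,\ldots,m$, $\tau_{ij}(t)$ is continuous and nonnegative on $[0,+\infty)$; (A5) there are a symmetric positive definite matrix $P\in\mathbb{R}^{n\times n}$, a diagonal matrix $\Delta=\mathrm{diag}\{\delta_1,\ldots,\delta_n\}$ and a constant $\epsilon>0$ such that $$(u_1-u_2)^{\top}P\{[f(t,u_1)-f(t,u_2)]-\Delta[u_1-u_2]\}\le-\epsilon(u_1-u_2)^{\top}(u_1-u_2)$$ for all $u_1,u_2\in\mathbb{R}^n$ and all $t\in[0,+\infty)$. Then, for any $\varphi(\theta)=[\varphi^1(\theta)^{\top},\ldots,\varphi^m(\theta)^{\top}]^{\top}$ with $\varphi^i\in C^{\infty}((-\infty,0],\mathbb{R}^n)$ for $i=1,\ldots,m$, there is a unique noncontinuable solution $x(t)=[x^1(t)^{\top},\ldots,x^m(t)^{\top}]^{\top}$ of $( * )$ through $(0,\varphi)$. Moreover, the interval of existence of the solution $x$ is $[0,+\infty)$.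
   Context: Here $\|\cdot\|$ is the Euclidean (2-)norm on $\mathbb{R}^n$. For $a\in\mathbb{R}$ and $N\ge1$, $C^{\infty}((-\infty,a],\mathbb{R}^N)$ does NOT denote smooth functions: it denotes the set of continuous functions $\phi:(-\infty,a]\to\mathbb{R}^N$ with $\sup_{-\infty<\theta\le a}\|\phi(\theta)\|<\infty$ such that $\lim_{\theta\to-\infty}\phi(\theta)$ exists in $\mathbb{R}^N$. A solution of $( * )$ through $(0,\varphi)$ on the interval $[0,B)$, with $0<B\le+\infty$, is a function $x=[(x^1)^\top,\ldots,(x^m)^\top]^\top:(-\infty,B)\to\mathbb{R}^{nm}$ whose restriction to $(-\infty,a]$ belongs to $C^{\infty}((-\infty,a],\mathbb{R}^{nm})$ for every $a<B$, such that $x(\theta)=\varphi(\theta)$ for all $\theta\le0$, and such that for every $t\in[0,B)$ the right-hand derivative of $x$ at $t$ exists and satisfies $( * )$. If $x$ and $y$ are solutions through $(0,\varphi)$ on intervals $I$ and $J$ respectively, both with left end point $0$, with $I$ properly contained in $J$ and $x(t)=y(t)$ for $t\in I$, then $y$ is called a continuation of $x$. A solution with no continuation is called noncontinuable (or maximal), and the interval $[0,B)$ on which it is defined is its interval of existence. *)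

theory Defs
  imports "HOL-Analysis.Analysis"
begin

text \<open>
  A finite signed measure on a measurable space \<open>M\<close> is a real-valued countably additive set
  function on \<^term>\<open>sets M\<close>; its values outside \<^term>\<open>sets M\<close> are irrelevant, and only the
  \<open>\<sigma>\<close>-algebra of \<open>M\<close> is used, not its measure.
\<close>

definition signed_measure :: "'a measure \<Rightarrow> ('a set \<Rightarrow> real) \<Rightarrow> bool" where
  "signed_measure M K \<longleftrightarrow> K {} = 0 \<and>
     (\<forall>A :: nat \<Rightarrow> 'a set. range A \<subseteq> sets M \<longrightarrow> disjoint_family A \<longrightarrow>
        (\<lambda>n. K (A n)) sums K (\<Union>n. A n))"

definition total_variation :: "'a measure \<Rightarrow> ('a set \<Rightarrow> real) \<Rightarrow> ennreal" where
  "total_variation M K =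
     (SUP \<P> \<in> {\<P>. finite \<P> \<and> \<P> \<subseteq> sets M \<and> disjoint \<P>}. \<Sum>A\<in>\<P>. ennreal \<bar>K A\<bar>)"

text \<open>
  The Jordan decomposition. In the supremum, \<^term>\<open>ennreal\<close> truncates negative values to 0,
  which changes nothing because the empty set is a competitor.
\<close>

definition upper_variation :: "'a measure \<Rightarrow> ('a set \<Rightarrow> real) \<Rightarrow> 'a measure" where
  "upper_variation M K =
     measure_of (space M) (sets M) (\<lambda>A. SUP B \<in> {B \<in> sets M. B \<subseteq> A}. ennreal (K B))"

definition lower_variation :: "'a measure \<Rightarrow> ('a set \<Rightarrow> real) \<Rightarrow> 'a measure" where
  "lower_variation M K = upper_variation M (\<lambda>A. - K A)"

definition signed_integral ::
    "'a measure \<Rightarrow> ('a set \<Rightarrow> real) \<Rightarrow> ('a \<Rightarrow> 'b) \<Rightarrow> 'b::{banach, second_countable_topology}" where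
  "signed_integral M K h =
     (LINT s|upper_variation M K. h s) - (LINT s|lower_variation M K. h s)"

abbreviation half_line :: "real measure" where
  "half_line \<equiv> restrict_space borel {0..}"

text \<open>
  \<open>C\<^sup>\<infinity>((-\<infinity>,a], \<real>\<^sup>N)\<close> (not smooth functions): bounded continuous functions with a limit at \<open>-\<infinity>\<close>.
  Membership depends only on the values on \<^term>\<open>{..a}\<close>.
\<close>

definition C_infinity :: "real \<Rightarrow> (real \<Rightarrow> 'v::euclidean_space) set" where
  "C_infinity a = {\<phi>. continuous_on {..a} \<phi> \<and> bdd_above ((\<lambda>\<theta>. norm (\<phi> \<theta>)) ` {..a}) \<and>
     (\<exists>L. (\<phi> \<longlongrightarrow> L) at_bot)}"

text \<open>
  The state space \<open>\<real>\<^sup>n\<^sup>m\<close> is \<^typ>\<open>real^'n^'m\<close>, with \<open>x\<^sup>i(t)\<close> being \<open>x t $ i\<close>; its norm is the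
  Euclidean norm of the stacked vector.
\<close>

definition coupled_rhs ::
    "(real \<Rightarrow> real^'n \<Rightarrow> real^'n) \<Rightarrow> (real \<Rightarrow> real^'n \<Rightarrow> real^'n) \<Rightarrow> (real \<Rightarrow> real^'m^'m) \<Rightarrow>
     ('m \<Rightarrow> 'm \<Rightarrow> real \<Rightarrow> real) \<Rightarrow> ('m \<Rightarrow> 'm \<Rightarrow> real set \<Rightarrow> real) \<Rightarrow>
     (real \<Rightarrow> real^'n^'m) \<Rightarrow> 'm \<Rightarrow> real \<Rightarrow> real^'n" where
  "coupled_rhs f g A \<tau> K x i t =
     f t (x t $ i) +
     (\<Sum>j\<in>UNIV. A t $ i $ j *\<^sub>R
        signed_integral half_line (K i j) (\<lambda>s. g t (x (t - \<tau> i j t - s) $ j)))"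

definition time_interval :: "ereal \<Rightarrow> real set" where
  "time_interval B = {t. 0 \<le> t \<and> ereal t < B}"

text \<open>
  A solution on \<open>[0,B)\<close>, \<open>0 < B \<le> \<infinity>\<close>, is a function with domain \<open>(-\<infinity>,B)\<close>; membership in
  \<^const>\<open>extensional\<close> makes equality of solutions equality on that domain.
\<close>

definition is_solution ::
    "(real \<Rightarrow> real^'n \<Rightarrow> real^'n) \<Rightarrow> (real \<Rightarrow> real^'n \<Rightarrow> real^'n) \<Rightarrow> (real \<Rightarrow> real^'m^'m) \<Rightarrow>
     ('m \<Rightarrow> 'm \<Rightarrow> real \<Rightarrow> real) \<Rightarrow> ('m \<Rightarrow> 'm \<Rightarrow> real set \<Rightarrow> real) \<Rightarrow>
     (real \<Rightarrow> real^'n^'m) \<Rightarrow> ereal \<Rightarrow> (real \<Rightarrow> real^'n^'m) \<Rightarrow> bool" where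
  "is_solution f g A \<tau> K \<phi> B x \<longleftrightarrow>
     0 < B \<and>
     x \<in> extensional {t. ereal t < B} \<and>
     (\<forall>a. ereal a < B \<longrightarrow> x \<in> C_infinity a) \<and>
     (\<forall>\<theta>\<le>0. x \<theta> = \<phi> \<theta>) \<and>
     (\<forall>t\<in>time_interval B. \<forall>i.
        ((\<lambda>s. x s $ i) has_vector_derivative coupled_rhs f g A \<tau> K x i t) (at_right t))"

definition is_continuation ::
    "(real \<Rightarrow> real^'n \<Rightarrow> real^'n) \<Rightarrow> (real \<Rightarrow> real^'n \<Rightarrow> real^'n) \<Rightarrow> (real \<Rightarrow> real^'m^'m) \<Rightarrow>
     ('m \<Rightarrow> 'm \<Rightarrow> real \<Rightarrow> real) \<Rightarrow> ('m \<Rightarrow> 'm \<Rightarrow> real set \<Rightarrow> real) \<Rightarrow>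
     (real \<Rightarrow> real^'n^'m) \<Rightarrow> ereal \<Rightarrow> (real \<Rightarrow> real^'n^'m) \<Rightarrow>
     ereal \<Rightarrow> (real \<Rightarrow> real^'n^'m) \<Rightarrow> bool" where
  "is_continuation f g A \<tau> K \<phi> B x B' y \<longleftrightarrow>
     is_solution f g A \<tau> K \<phi> B x \<and> is_solution f g A \<tau> K \<phi> B' y \<and>
     time_interval B \<subset> time_interval B' \<and> (\<forall>t\<in>time_interval B. x t = y t)"

definition noncontinuable_solution ::
    "(real \<Rightarrow> real^'n \<Rightarrow> real^'n) \<Rightarrow> (real \<Rightarrow> real^'n \<Rightarrow> real^'n) \<Rightarrow> (real \<Rightarrow> real^'m^'m) \<Rightarrow>
     ('m \<Rightarrow> 'm \<Rightarrow> real \<Rightarrow> real) \<Rightarrow> ('m \<Rightarrow> 'm \<Rightarrow> real set \<Rightarrow> real) \<Rightarrow>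
     (real \<Rightarrow> real^'n^'m) \<Rightarrow> ereal \<Rightarrow> (real \<Rightarrow> real^'n^'m) \<Rightarrow> bool" where
  "noncontinuable_solution f g A \<tau> K \<phi> B x \<longleftrightarrow>
     is_solution f g A \<tau> K \<phi> B x \<and> \<not> (\<exists>B' y. is_continuation f g A \<tau> K \<phi> B x B' y)"

definition diag_matrix :: "real^'n \<Rightarrow> real^'n^'n" where
  "diag_matrix \<delta> = (\<chi> i j. if i = j then \<delta> $ i else 0)"

definition symmetric_positive_definite :: "real^'n^'n \<Rightarrow> bool" where
  "symmetric_positive_definite P \<longleftrightarrow> transpose P = P \<and> (\<forall>u. u \<noteq> 0 \<longrightarrow> u \<bullet> (P *v u) > 0)"

end

theory Submission
  imports Defs
begin

text \<open>
  The stacked system has the form \<open>x' = F t x(t) + G t x\<close>, where \<open>G\<close> is Lipschitz in the history of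
  \<open>x\<close> and, by (A5), \<open>F\<close> is one-sided Lipschitz for the inner product \<open>u \<bullet> P v\<close>. With
  \<open>V u = u \<bullet> P u\<close>, the right derivative of \<open>V\<close> along the difference of two solutions is at most a
  constant times the supremum of \<open>V\<close> over the past, so an exponential barrier \<open>E\<^sub>0 exp (L t)\<close> of large
  rate \<open>L\<close> cannot be crossed; letting \<open>E\<^sub>0 \<rightarrow> 0\<close> gives uniqueness. The same barrier argument against the
  zero function bounds every solution on \<open>[0,T]\<close> a priori by some \<open>R\<close>. Composing \<open>F\<close> with the
  projection onto the ball of radius \<open>R\<close> makes it globally Lipschitz, Banach's fixed point theorem
  in a weighted supremum norm solves the truncated equation on \<open>[0,T]\<close>, and by the a priori bound
  the truncation is never active.
\<close>

section \<open>Continuous induction and bounds on compact intervals\<close>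

text \<open>Take the supremum \<open>r\<close> of the initial segments on which \<open>u\<close> is
  nonpositive. Continuity from the left carries the sign to \<open>r\<close>, and
  \<open>step\<close> pushes it strictly past \<open>r\<close> unless \<open>r\<close> is already
  the right end. The step may use the sign on the whole segment, as delay equations demand.\<close>

lemma nonpos_interval_induct:
  fixes u :: "real \<Rightarrow> real"
  assumes cont: "continuous_on {a..b} u" and init: "u a \<le> 0"
    and step: "\<And>t. a \<le> t \<Longrightarrow> t < b \<Longrightarrow> (\<And>s. a \<le> s \<Longrightarrow> s \<le> t \<Longrightarrow> u s \<le> 0) \<Longrightarrow>
      \<forall>\<^sub>F s in at_right t. u s \<le> 0"
    and t: "a \<le> t" "t \<le> b"
  shows "u t \<le> 0"
proof (rule ccontr)
  assume neg: "\<not> u t \<le> 0"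
  define S where "S = {r \<in> {a..t}. \<forall>s\<in>{a..r}. u s \<le> 0}"
  define r where "r = Sup S"
  have aS: "a \<in> S" using init t by (auto simp: S_def)
  have bdd: "bdd_above S" by (rule bdd_above_mono[OF bdd_above_Icc[of a t]]) (unfold S_def, blast)
  have r: "a \<le> r" "r \<le> t"
    unfolding r_def
    by (rule cSup_upper[OF aS bdd]) (rule cSup_least, use aS in blast, unfold S_def, simp)
  have before: "u s \<le> 0" if "a \<le> s" "s < r" for s
  proof -
    from that(2) obtain r' where "r' \<in> S" "s < r'"
      unfolding r_def using less_cSup_iff[OF _ bdd] aS by blast
    then show ?thesis using that by (auto simp: S_def)
  qed
  have ur: "u r \<le> 0"
  proof (cases "r = a")
    case False
    then have ar: "a < r" using r by simp
    have "(u \<longlongrightarrow> u r) (at r within {a..b})"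
      using cont r t by (auto simp: continuous_on)
    then have "(u \<longlongrightarrow> u r) (at r within {a..r})"
      by (rule tendsto_within_subset) (use r t in auto)
    then have "(u \<longlongrightarrow> u r) (at_left r)"
      by (simp add: at_within_Icc_at_left[OF ar])
    moreover have "\<forall>\<^sub>F s in at_left r. u s \<le> 0"
      using eventually_at_left_real[OF ar] by eventually_elim (use before in auto)
    ultimately show ?thesis
      by (intro tendsto_upperbound) auto
  qed (use init in simp)
  have le: "u s \<le> 0" if "a \<le> s" "s \<le> r" for s
    using before[of s] ur that by (cases "s = r") auto
  have rt: "r < t" using ur neg r by (cases "r = t") auto
  have "\<forall>\<^sub>F s in at_right r. u s \<le> 0"
    using step[of r] le r rt t by auto
  then obtain d where d: "d > r" "\<And>s. r < s \<Longrightarrow> s < d \<Longrightarrow> u s \<le> 0"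
    unfolding eventually_at_right_field by blast
  \<comment> \<open>A point beyond \<open>r\<close> but inside the reach of the step, cut off at
    \<open>t\<close> so that it still competes in \<open>S\<close>.\<close>
  define e where "e = min t ((r + d) / 2)"
  have e: "r < e" "e \<le> t" "e < d" using d rt by (auto simp: e_def min_def field_simps)
  have "e \<in> S"
    using e r le d(2) by (force simp: S_def not_le)
  then show False using cSup_upper[OF _ bdd, of e] e by (simp add: r_def)
qed

lemma compact_interval_norm_bound:
  fixes h :: "real \<Rightarrow> 'a::real_normed_vector"
  assumes "continuous_on {0..} h"
  obtains B where "0 \<le> B" "\<And>t. 0 \<le> t \<Longrightarrow> t \<le> T \<Longrightarrow> norm (h t) \<le> B"
proof -
  have "bounded (h ` {0..T})"
    by (intro compact_imp_bounded compact_continuous_image continuous_on_subset[OF assms]) auto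
  then obtain B where "B > 0" "\<And>t. 0 \<le> t \<Longrightarrow> t \<le> T \<Longrightarrow> norm (h t) \<le> B"
    unfolding bounded_pos by auto
  then show thesis by (intro that[of B]) auto
qed

section \<open>An abstract functional differential equation with one-sided Lipschitz drift\<close>

text \<open>\<open>G_lip\<close> measures the difference of two histories up to time
  \<open>t\<close> only, so with \<open>D = 0\<close> it also makes \<open>G\<close> causal.
  \<open>F_lip\<close> provides local existence through truncation, while \<open>F_one_sided\<close>
  gives constants independent of the size of the solution and thereby excludes blow-up.\<close>

locale fde =
  fixes F :: "real \<Rightarrow> 'v::euclidean_space \<Rightarrow> 'v"
    and G :: "real \<Rightarrow> (real \<Rightarrow> 'v) \<Rightarrow> 'v"
    and k :: "real \<Rightarrow> real" and P :: "'v \<Rightarrow> 'v" and lam c :: real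
  assumes F_cont: "continuous_on ({0..} \<times> UNIV) (\<lambda>(t, u). F t u)"
    and F_lip: "\<And>T R. \<exists>l\<ge>0. \<forall>t\<in>{0..T}. \<forall>u\<in>cball 0 R. \<forall>v\<in>cball 0 R.
      norm (F t u - F t v) \<le> l * norm (u - v)"
    and F_one_sided: "\<And>t u v. 0 \<le> t \<Longrightarrow> (u - v) \<bullet> P (F t u - F t v) \<le> c * (norm (u - v))\<^sup>2"
    and G_lip: "\<And>t x y D. 0 \<le> t \<Longrightarrow> continuous_on {..t} x \<Longrightarrow> bounded (x ` {..t}) \<Longrightarrow>
      continuous_on {..t} y \<Longrightarrow> bounded (y ` {..t}) \<Longrightarrow>
      (\<And>s. s \<le> t \<Longrightarrow> norm (x s - y s) \<le> D) \<Longrightarrow> norm (G t x - G t y) \<le> k t * D"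
    and G_cont: "\<And>x. continuous_on UNIV x \<Longrightarrow> bounded (range x) \<Longrightarrow>
      continuous_on {0..} (\<lambda>t. G t x)"
    and k_cont: "continuous_on {0..} k"
    and P_linear: "bounded_linear P" and P_sym: "\<And>u v. u \<bullet> P v = P u \<bullet> v"
    and lam_pos: "0 < lam" and P_coercive: "\<And>u. lam * (norm u)\<^sup>2 \<le> u \<bullet> P u"
    and c_nonneg: "0 \<le> c"
begin

definition V :: "'v \<Rightarrow> real" where "V u = u \<bullet> P u"

lemma P_bound: "u \<bullet> P v \<le> onorm P * norm u * norm v"
proof -
  have "u \<bullet> P v \<le> norm u * norm (P v)" by (rule norm_cauchy_schwarz)
  also have "\<dots> \<le> norm u * (onorm P * norm v)"
    by (intro mult_left_mono onorm[OF P_linear]) auto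
  finally show ?thesis by (simp add: ac_simps)
qed

lemma onorm_P_nonneg: "0 \<le> onorm P"
  by (rule onorm_pos_le[OF P_linear])

lemma V_upper: "V u \<le> onorm P * (norm u)\<^sup>2"
  using P_bound[of u u] by (simp add: V_def power2_eq_square ac_simps)

lemma V_has_derivative:
  assumes "(d has_vector_derivative d') (at t within S)"
  shows "((\<lambda>s. V (d s)) has_real_derivative 2 * (d t \<bullet> P d')) (at t within S)"
proof -
  have "((\<lambda>s. d s \<bullet> P (d s)) has_vector_derivative (d t \<bullet> P d' + d' \<bullet> P (d t))) (at t within S)"
    by (rule bounded_bilinear.has_vector_derivative[OF bounded_bilinear_inner assms
          bounded_linear.has_vector_derivative[OF P_linear assms]])
  then show ?thesis
    by (simp add: V_def has_real_derivative_iff_has_vector_derivative P_sym[of d'] inner_commute)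
qed

lemma continuous_on_V: "continuous_on S d \<Longrightarrow> continuous_on S (\<lambda>s. V (d s))"
  unfolding V_def by (intro continuous_intros bounded_linear.continuous_on[OF P_linear])

text \<open>
  The hypothesis \<open>step\<close> is only required at times up to which \<open>d\<close> stays below the barrier; the a priori
  bound for the truncated equation relies on this.
\<close>

lemma growth_bound:
  assumes cont: "continuous_on {0..b} d" and E0: "0 < E0"
    and L: "0 \<le> L"
    and init: "V (d 0) \<le> E0" and hist: "\<And>s. s \<le> 0 \<Longrightarrow> lam * (norm (d s))\<^sup>2 \<le> E0"
    and step: "\<And>t M. 0 \<le> t \<Longrightarrow> t < b \<Longrightarrow> 0 \<le> M \<Longrightarrow> lam * M\<^sup>2 = E0 * exp (L * t) \<Longrightarrow>
      (\<And>s. s \<le> t \<Longrightarrow> norm (d s) \<le> M) \<Longrightarrow>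
      \<exists>d'. (d has_vector_derivative d') (at_right t) \<and> 2 * (d t \<bullet> P d') < L * (lam * M\<^sup>2)"
    and t: "0 \<le> t" "t \<le> b"
  shows "V (d t) \<le> E0 * exp (L * t)"
proof -
  define u where "u s = V (d s) - E0 * exp (L * s)" for s
  have "u t \<le> 0"
  proof (rule nonpos_interval_induct[of 0 b u])
    show "continuous_on {0..b} u"
      unfolding u_def by (intro continuous_intros continuous_on_V cont)
    show "u 0 \<le> 0" using init by (simp add: u_def)
  next
    fix r assume r: "0 \<le> r" "r < b" and le: "\<And>s. 0 \<le> s \<Longrightarrow> s \<le> r \<Longrightarrow> u s \<le> 0"
    \<comment> \<open>The barrier is nondecreasing, so its value at \<open>r\<close> dominates all
      earlier ones; by coercivity, \<open>M\<close> then bounds the norm of \<open>d\<close> on the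
      whole past of \<open>r\<close>.\<close>
    define M where "M = sqrt (E0 * exp (L * r) / lam)"
    have M: "0 \<le> M" "lam * M\<^sup>2 = E0 * exp (L * r)"
      using E0 lam_pos by (auto simp: M_def)
    have bnd: "norm (d s) \<le> M" if "s \<le> r" for s
    proof -
      have "lam * (norm (d s))\<^sup>2 \<le> lam * M\<^sup>2"
      proof (cases "s \<le> 0")
        case True
        have "E0 * 1 \<le> E0 * exp (L * r)"
          using E0 L r by (intro mult_left_mono) auto
        then show ?thesis using hist[OF True] M by simp
      next
        case False
        have "E0 * exp (L * s) \<le> E0 * exp (L * r)"
          using E0 L that by (intro mult_left_mono) (auto intro: mult_left_mono)
        then show ?thesis
          using le[of s] False that P_coercive[of "d s"] M by (simp add: u_def V_def)
      qed
      then show ?thesis using lam_pos M(1) by (simp add: power2_le_iff_abs_le)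
    qed
    obtain d' where d': "(d has_vector_derivative d') (at_right r)"
      "2 * (d r \<bullet> P d') < L * (lam * M\<^sup>2)"
      using step[OF r M bnd] by blast
    \<comment> \<open>This derivative is strictly negative, so \<open>u\<close> drops to the right
      of \<open>r\<close> even when the barrier is touched, that is, when
      \<open>u r = 0\<close>.\<close>
    have der: "(u has_real_derivative 2 * (d r \<bullet> P d') - E0 * (exp (L * r) * L)) (at_right r)"
      unfolding u_def by (auto intro!: derivative_eq_intros V_has_derivative d')
    have neg: "2 * (d r \<bullet> P d') - E0 * (exp (L * r) * L) < 0"
      using d'(2) by (simp add: M(2) algebra_simps)
    obtain e where e: "e > 0" "\<And>h. h > 0 \<Longrightarrow> h < e \<Longrightarrow> u (r + h) < u r"
      using has_real_derivative_neg_dec_right[OF der neg] by auto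
    have "u s \<le> 0" if "r < s" "s < r + e" for s
      using e(2)[of "s - r"] that le[of r] r by auto
    then show "\<forall>\<^sub>F s in at_right r. u s \<le> 0"
      unfolding eventually_at_right_field using e(1) by (intro exI[of _ "r + e"]) auto
  qed (use t in auto)
  then show ?thesis by (simp add: u_def)
qed

lemma k_bound: obtains k1 where "0 \<le> k1" "\<And>t. 0 \<le> t \<Longrightarrow> t \<le> T \<Longrightarrow> k t \<le> k1"
  using compact_interval_norm_bound[OF k_cont, of T]
  by (metis abs_le_D1 real_norm_def)

text \<open>The difference of the solutions has zero history, so \<open>growth_bound\<close> applies
  with every positive initial height. In the derivative of \<open>V\<close>, the drift is controlled
  by the one-sided inequality and the delay part by its Lipschitz bound.\<close>

lemma solutions_agree:
  assumes x: "continuous_on {..b} x" "bounded (x ` {..b})"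
    and y: "continuous_on {..b} y" "bounded (y ` {..b})"
    and hist: "\<And>s. s \<le> 0 \<Longrightarrow> x s = y s"
    and dx: "\<And>t. 0 \<le> t \<Longrightarrow> t < b \<Longrightarrow>
      (x has_vector_derivative (F t (x t) + G t x)) (at_right t)"
    and dy: "\<And>t. 0 \<le> t \<Longrightarrow> t < b \<Longrightarrow>
      (y has_vector_derivative (F t (y t) + G t y)) (at_right t)"
    and t: "t \<le> b"
  shows "x t = y t"
proof (cases "t \<le> 0")
  case True
  then show ?thesis by (rule hist)
next
  case False
  obtain k1 where k1: "0 \<le> k1" "\<And>t. 0 \<le> t \<Longrightarrow> t \<le> b \<Longrightarrow> k t \<le> k1"
    by (rule k_bound[of b]) blast
  \<comment> \<open>\<open>2 * c\<close> pays for the drift and \<open>2 * onorm P * k1\<close> for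
    the delay part. The extra 1 makes the inequality strict, and dividing by \<open>lam\<close>
    compensates for the barrier being \<open>lam * M\<^sup>2\<close>.\<close>
  define L where "L = (2 * c + 2 * onorm P * k1 + 1) / lam"
  have L0: "0 \<le> L" and Llam: "L * lam = 2 * c + 2 * onorm P * k1 + 1"
    using c_nonneg onorm_P_nonneg k1 lam_pos by (auto simp: L_def)
  define d where "d s = x s - y s" for s
  have Vd: "V (d t) \<le> e * exp (L * t)" if e: "e > 0" for e
  proof (rule growth_bound[of b d])
    show "continuous_on {0..b} d"
      unfolding d_def by (intro continuous_intros continuous_on_subset[OF x(1)]
          continuous_on_subset[OF y(1)]) auto
    show "V (d 0) \<le> e" "\<And>s. s \<le> 0 \<Longrightarrow> lam * (norm (d s))\<^sup>2 \<le> e"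
      using e hist linear_0[OF bounded_linear.linear[OF P_linear]] by (auto simp: d_def V_def)
  next
    fix r M assume r: "0 \<le> r" "r < b" and M: "0 \<le> M" "lam * M\<^sup>2 = e * exp (L * r)"
      and bnd: "\<And>s. s \<le> r \<Longrightarrow> norm (d s) \<le> M"
    have Mpos: "0 < M\<^sup>2" using M(2) e lam_pos by (metis exp_gt_zero mult_pos_pos zero_less_mult_pos)
    define d' where "d' = (F r (x r) - F r (y r)) + (G r x - G r y)"
    have G: "norm (G r x - G r y) \<le> k1 * M"
    proof -
      have "norm (G r x - G r y) \<le> k r * M"
        using r bnd by (intro G_lip continuous_on_subset[OF x(1)] continuous_on_subset[OF y(1)]
          bounded_subset[OF x(2)] bounded_subset[OF y(2)]) (auto simp: d_def)
      also have "\<dots> \<le> k1 * M" using k1 r M by (intro mult_right_mono) auto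
      finally show ?thesis .
    qed
    have "d r \<bullet> P d' = d r \<bullet> P (F r (x r) - F r (y r)) + d r \<bullet> P (G r x - G r y)"
      unfolding d'_def by (simp add: linear_add[OF bounded_linear.linear[OF P_linear]] inner_add_right)
    also have "\<dots> \<le> c * (norm (d r))\<^sup>2 + onorm P * norm (d r) * norm (G r x - G r y)"
      unfolding d_def by (intro add_mono F_one_sided P_bound r)
    also have "\<dots> \<le> c * M\<^sup>2 + onorm P * M * (k1 * M)"
      using bnd[of r] M(1) G c_nonneg onorm_P_nonneg k1
      by (intro add_mono mult_mono power_mono mult_nonneg_nonneg) auto
    finally have "2 * (d r \<bullet> P d') \<le> (2 * c + 2 * onorm P * k1) * M\<^sup>2"
      by (simp add: power2_eq_square algebra_simps)
    also have "\<dots> < L * lam * M\<^sup>2" using Mpos by (simp add: Llam)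
    finally have "2 * (d r \<bullet> P d') < L * (lam * M\<^sup>2)" by (simp add: ac_simps)
    moreover have "(d has_vector_derivative d') (at_right r)"
      unfolding d_def d'_def
      using has_vector_derivative_diff[OF dx[OF r] dy[OF r]] by (simp add: algebra_simps)
    ultimately show "\<exists>d'. (d has_vector_derivative d') (at_right r) \<and>
        2 * (d r \<bullet> P d') < L * (lam * M\<^sup>2)" by blast
  qed (use that L0 t False in auto)
  have "V (d t) \<le> 0"
  proof (rule field_le_epsilon)
    fix e :: real assume "0 < e"
    then show "V (d t) \<le> 0 + e" using Vd[of "e / exp (L * t)"] by simp
  qed
  then have "lam * (norm (d t))\<^sup>2 \<le> 0" using P_coercive[of "d t"] by (simp add: V_def)
  then show ?thesis using lam_pos by (simp add: mult_le_0_iff d_def)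
qed

text \<open>The projection is nonexpansive and takes values in one ball, on which
  \<open>F_lip\<close> supplies a single constant for all of \<open>{0..T}\<close>. The truncated
  right-hand side is therefore globally Lipschitz in the history, and Picard iteration works on the
  full interval at once.\<close>

lemma truncated_solution:
  assumes hist: "continuous_on {..0} \<phi>" "bounded (\<phi> ` {..0})" and T: "0 < T" and R: "0 \<le> R"
  obtains x where "continuous_on UNIV x" "bounded (range x)" "\<And>s. s \<le> 0 \<Longrightarrow> x s = \<phi> s"
    "\<And>t. 0 \<le> t \<Longrightarrow> t < T \<Longrightarrow>
      (x has_vector_derivative (F t (closest_point (cball 0 R) (x t)) + G t x)) (at_right t)"
proof -
  define \<pi> :: "'v \<Rightarrow> 'v" where "\<pi> = closest_point (cball 0 R)"
  have \<pi>: "\<pi> u \<in> cball 0 R" "norm (\<pi> u - \<pi> v) \<le> norm (u - v)" for u v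
    unfolding \<pi>_def dist_norm[symmetric]
    using R by (intro closest_point_in_set closest_point_lipschitz; simp)+
  have \<pi>_cont: "continuous_on UNIV \<pi>"
    unfolding \<pi>_def using R by (intro continuous_on_closest_point) auto
  obtain l where l: "0 \<le> l" "\<And>t u v. t \<in> {0..T} \<Longrightarrow> u \<in> cball 0 R \<Longrightarrow> v \<in> cball 0 R \<Longrightarrow>
      norm (F t u - F t v) \<le> l * norm (u - v)"
    using F_lip[of T R] by blast
  obtain k1 where k1: "0 \<le> k1" "\<And>t. 0 \<le> t \<Longrightarrow> t \<le> T \<Longrightarrow> k t \<le> k1"
    by (rule k_bound[of T]) blast
  \<comment> \<open>\<open>C\<close> exceeds the Lipschitz constant \<open>l + k1\<close> of the
    truncated right-hand side; the extra 1 keeps the rate of the weight positive.\<close>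
  define C where "C = l + k1 + 1"
  have C: "0 < C" using l k1 by (simp add: C_def)
  \<comment> \<open>Clamping time freezes the weight outside \<open>{0..T}\<close> and the integral
    term beyond \<open>T\<close>, so all functions live on the whole line and stay bounded, as the
    type of bounded continuous functions requires.\<close>
  define clip where "clip t = max 0 (min t T)" for t :: real
  have clip: "0 \<le> clip t" "clip t \<le> T" "s \<le> t \<Longrightarrow> clip s \<le> clip t"
    "t \<in> {0..T} \<Longrightarrow> clip t = t" for s t
    using T by (auto simp: clip_def)
  have clip_cont: "continuous_on S clip" for S
    unfolding clip_def by (intro continuous_intros)
  \<comment> \<open>the fixed point is sought as \<open>z = x / w\<close>: this weight makes the integral operator a
    contraction with constant \<open>1/2\<close> on all of \<open>[0,T]\<close>\<close>
  define w where "w s = exp (2 * C * clip s)" for s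
  have w: "1 \<le> w s" "w s \<le> exp (2 * C * T)" "s \<le> t \<Longrightarrow> w s \<le> w t" for s t
    using clip[of s] clip(3)[of s t] C by (auto simp: w_def)
  have w_cont: "continuous_on S w" for S
    unfolding w_def by (intro continuous_intros clip_cont)
  define X where "X z s = w s *\<^sub>R apply_bcontfun z s" for z :: "real \<Rightarrow>\<^sub>C 'v" and s
  have X_cont: "continuous_on S (X z)" for S z
    unfolding X_def by (intro continuous_intros w_cont) auto
  have X_bdd: "bounded (X z ` S)" for S z
  proof -
    have "norm (X z s) \<le> exp (2 * C * T) * norm z" for s
      unfolding X_def using w[of s] norm_bounded[of z s]
      by (auto intro!: mult_mono)
    then show ?thesis by (auto simp: bounded_iff)
  qed
  define h where "h z s = F s (\<pi> (X z s)) + G s (X z)" for z s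
  have h_cont: "continuous_on {0..T} (h z)" for z
  proof -
    have "continuous_on {0..T} (\<lambda>s. (\<lambda>(t, u). F t u) (s, \<pi> (X z s)))"
      by (rule continuous_on_compose2[OF F_cont])
        (auto intro!: continuous_intros continuous_on_compose2[OF \<pi>_cont] X_cont)
    moreover have "continuous_on {0..T} (\<lambda>s. G s (X z))"
      by (rule continuous_on_subset[OF G_cont]) (auto intro: X_cont X_bdd)
    ultimately show ?thesis unfolding h_def by (auto intro: continuous_on_add)
  qed
  have h_int: "h z integrable_on {0..r}" if "r \<le> T" for r z
    by (intro integrable_continuous_real continuous_on_subset[OF h_cont]) (use that in auto)
  have h_diff: "norm (h z s - h z' s) \<le> C * dist z z' * exp (2 * C * s)"
    if s: "s \<in> {0..T}" for z z' s
  proof -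
    \<comment> \<open>Since the weight is nondecreasing, controlling the entire past costs no more
      than the weight at the present time \<open>s\<close>.\<close>
    have X_diff: "norm (X z r - X z' r) \<le> w s * dist z z'" if "r \<le> s" for r
    proof -
      have "norm (X z r - X z' r) = w r * dist (apply_bcontfun z r) (apply_bcontfun z' r)"
        using w[of r] by (simp add: X_def dist_norm flip: scaleR_right_diff_distrib)
      also have "\<dots> \<le> w s * dist z z'"
        using w(3)[OF that] w(1)[of s] by (intro mult_mono dist_bounded) auto
      finally show ?thesis .
    qed
    have "norm (F s (\<pi> (X z s)) - F s (\<pi> (X z' s))) \<le> l * norm (\<pi> (X z s) - \<pi> (X z' s))"
      by (intro l \<pi> s)
    also have "\<dots> \<le> l * (w s * dist z z')"
      by (intro mult_left_mono l order_trans[OF \<pi>(2)] X_diff) auto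
    finally have 1: "norm (F s (\<pi> (X z s)) - F s (\<pi> (X z' s))) \<le> l * (w s * dist z z')" .
    have "norm (G s (X z) - G s (X z')) \<le> k s * (w s * dist z z')"
      using s by (intro G_lip X_cont X_bdd X_diff) auto
    also have "\<dots> \<le> k1 * (w s * dist z z')"
      using k1 s w(1)[of s] by (intro mult_right_mono) auto
    finally have "norm (G s (X z) - G s (X z')) \<le> k1 * (w s * dist z z')" .
    then have "norm (h z s - h z' s) \<le> l * (w s * dist z z') + k1 * (w s * dist z z')"
      unfolding h_def add_diff_add by (intro norm_triangle_le add_mono 1)
    also have "\<dots> \<le> C * dist z z' * w s"
      using w(1)[of s] by (simp add: C_def algebra_simps)
    finally show ?thesis using clip(4)[OF s] by (simp add: w_def)
  qed
  \<comment> \<open>The Picard operator: \<open>min t 0\<close> replays the history before time 0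
    and holds the value at 0 afterwards, while the integral vanishes before time 0.\<close>
  define Y where "Y z t = \<phi> (min t 0) + integral {0..clip t} (h z)" for z t
  have Y_diff: "norm (Y z t - Y z' t) \<le> w t * (dist z z' / 2)" for z z' t
  proof -
    define r where "r = clip t"
    have r: "0 \<le> r" "r \<le> T" unfolding r_def by (rule clip)+
    \<comment> \<open>The weight grows at rate \<open>2 * C\<close>, so integrating \<open>C\<close>
      times it returns at most half of it: this is the contraction factor.\<close>
    have "((\<lambda>s. C * dist z z' * exp (2 * C * s)) has_integral
      (dist z z' / 2 * exp (2 * C * r) - dist z z' / 2 * exp (2 * C * 0))) {0..r}"
      using C r(1) by (intro fundamental_theorem_of_calculus)
        (auto intro!: derivative_eq_intros simp flip: has_real_derivative_iff_has_vector_derivative)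
    note I = this
    have "norm (Y z t - Y z' t) = norm (integral {0..r} (\<lambda>s. h z s - h z' s))"
      using r by (simp add: Y_def r_def[symmetric] Henstock_Kurzweil_Integration.integral_diff h_int)
    also have "\<dots> \<le> integral {0..r} (\<lambda>s. C * dist z z' * exp (2 * C * s))"
      using r by (intro Henstock_Kurzweil_Integration.integral_norm_bound_integral h_diff
        has_integral_integrable[OF I] Henstock_Kurzweil_Integration.integrable_diff h_int) auto
    also have "\<dots> = dist z z' / 2 * exp (2 * C * r) - dist z z' / 2"
      using integral_unique[OF I] by simp
    also have "\<dots> \<le> w t * (dist z z' / 2)" by (simp add: w_def r_def)
    finally show ?thesis .
  qed
  have Y_cont: "continuous_on UNIV (Y z)" for z
    unfolding Y_def
    by (intro continuous_intros continuous_on_compose2[OF hist(1)]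
        continuous_on_compose2[OF indefinite_integral_continuous_1[OF h_int[OF order_refl]]] clip_cont)
      (use clip in auto)
  have Y_bdd: "bounded (range (Y z))" for z
  proof -
    have "compact ((\<lambda>r. integral {0..r} (h z)) ` {0..T})"
      by (intro compact_continuous_image indefinite_integral_continuous_1 h_int) auto
    then have "bounded ((\<lambda>r. integral {0..r} (h z)) ` {0..T})" by (rule compact_imp_bounded)
    from bounded_plus[OF hist(2) this]
    show ?thesis
      by (rule bounded_subset) (use clip in \<open>force simp: Y_def\<close>)
  qed
  \<comment> \<open>Dividing the weight out again turns the weighted estimate for \<open>Y\<close>
    into a contraction in the ordinary supremum metric, which is complete.\<close>
  define \<Phi> where "\<Phi> z = Bcontfun (\<lambda>t. (1 / w t) *\<^sub>R Y z t)" for z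
  have \<Phi>: "apply_bcontfun (\<Phi> z) t = (1 / w t) *\<^sub>R Y z t" for z t
  proof -
    obtain B where B: "\<And>t. norm (Y z t) \<le> B" using Y_bdd[of z] by (auto simp: bounded_iff)
    have w0: "w t \<noteq> 0" for t using w(1)[of t] by auto
    have "(\<lambda>t. (1 / w t) *\<^sub>R Y z t) \<in> bcontfun"
    proof (rule bcontfun_normI)
      show "continuous_on UNIV (\<lambda>t. (1 / w t) *\<^sub>R Y z t)"
        by (intro continuous_intros w_cont Y_cont) (simp add: w0)
      show "norm ((1 / w t) *\<^sub>R Y z t) \<le> B" for t
      proof -
        have "norm ((1 / w t) *\<^sub>R Y z t) = (1 / w t) * norm (Y z t)" using w(1)[of t] by simp
        also have "\<dots> \<le> 1 * norm (Y z t)" using w(1)[of t] by (intro mult_right_mono) auto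
        finally show ?thesis using B[of t] by simp
      qed
    qed
    then show ?thesis by (simp add: \<Phi>_def Bcontfun_inverse)
  qed
  have "dist (\<Phi> z) (\<Phi> z') \<le> (1 / 2) * dist z z'" for z z'
  proof (rule dist_bound)
    fix t
    have "dist (\<Phi> z t) (\<Phi> z' t) = (1 / w t) * norm (Y z t - Y z' t)"
      using w(1)[of t] by (simp add: \<Phi> dist_norm flip: scaleR_right_diff_distrib)
    also have "\<dots> \<le> (1 / w t) * (w t * (dist z z' / 2))"
      using w(1)[of t] by (intro mult_left_mono Y_diff) auto
    also have "\<dots> = (1 / 2) * dist z z'" using w(1)[of t] by simp
    finally show "dist (\<Phi> z t) (\<Phi> z' t) \<le> (1 / 2) * dist z z'" .
  qed
  then have "\<exists>!z. \<Phi> z = z"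
    by (intro banach_fix_type[of "1 / 2"]) auto
  then obtain z where z: "\<Phi> z = z" by blast
  have XY: "X z t = Y z t" for t
  proof -
    have "X z t = w t *\<^sub>R apply_bcontfun (\<Phi> z) t" by (simp add: X_def z)
    also have "\<dots> = Y z t" using w(1)[of t] unfolding \<Phi> by auto
    finally show ?thesis .
  qed
  show thesis
  proof (rule that[of "X z"])
    show "X z s = \<phi> s" if "s \<le> 0" for s
      using that T by (simp add: XY Y_def clip_def)
    show "(X z has_vector_derivative (F t (closest_point (cball 0 R) (X z t)) + G t (X z))) (at_right t)"
      if t: "0 \<le> t" "t < T" for t
    proof -
      \<comment> \<open>The integrand is known to be continuous on \<open>{0..T}\<close> only, so
        the derivative is taken within that interval; shrinking it to \<open>{t..T}\<close> leaves
        the right derivative because \<open>t < T\<close>.\<close>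
      have "((\<lambda>r. \<phi> 0 + integral {0..r} (h z)) has_vector_derivative h z t) (at t within {0..T})"
        using integral_has_vector_derivative[OF h_cont, of t z] t
        by (auto intro!: derivative_eq_intros)
      then have "((\<lambda>r. \<phi> 0 + integral {0..r} (h z)) has_vector_derivative h z t) (at t within {t..T})"
        by (rule has_vector_derivative_within_subset) (use t in auto)
      then have "(X z has_vector_derivative h z t) (at t within {t..T})"
        by (rule has_vector_derivative_transform[rotated 2])
          (use t clip(4) in \<open>auto simp: XY Y_def min_absorb2\<close>)
      then show ?thesis
        using at_within_Icc_at_right[OF t(2)] by (simp add: h_def \<pi>_def)
    qed
  qed (rule X_cont X_bdd)+
qed

text \<open>There is no circularity in removing the truncation: while \<open>x\<close> is below the
  barrier, the projection fixes \<open>x r\<close>, so the step condition of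
  \<open>growth_bound\<close> can be checked with \<open>F\<close> itself. The conclusion then
  confines \<open>x\<close> to the ball on all of \<open>{0..T}\<close>.\<close>

lemma solution_on_interval:
  assumes hist: "continuous_on {..0} \<phi>" "bounded (\<phi> ` {..0})" and T: "0 < T"
  obtains x where "continuous_on UNIV x" "bounded (range x)" "\<And>s. s \<le> 0 \<Longrightarrow> x s = \<phi> s"
    "\<And>t. 0 \<le> t \<Longrightarrow> t < T \<Longrightarrow>
      (x has_vector_derivative (F t (x t) + G t x)) (at_right t)"
proof -
  obtain k1 where k1: "0 \<le> k1" "\<And>t. 0 \<le> t \<Longrightarrow> t \<le> T \<Longrightarrow> k t \<le> k1"
    by (rule k_bound[of T]) blast
  obtain H where H: "\<And>s. s \<le> 0 \<Longrightarrow> norm (\<phi> s) \<le> H"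
    using hist(2) by (auto simp: bounded_iff)
  \<comment> \<open>The right-hand side along the zero function acts as a forcing term when
    \<open>x\<close> is compared with 0.\<close>
  define g0 where "g0 t = F t 0 + G t (\<lambda>_. 0)" for t
  have "continuous_on {0..T} (\<lambda>t. (\<lambda>(t, u). F t u) (t, 0))"
    by (rule continuous_on_compose2[OF F_cont]) (auto intro!: continuous_intros)
  moreover have "continuous_on {0..T} (\<lambda>t. G t (\<lambda>_. 0))"
    by (rule continuous_on_subset[OF G_cont]) auto
  ultimately have "continuous_on {0..T} g0"
    unfolding g0_def by (auto intro: continuous_on_add)
  then have "bounded (g0 ` {0..T})"
    by (intro compact_imp_bounded compact_continuous_image) auto
  then obtain q where q: "0 < q" "\<And>t. 0 \<le> t \<Longrightarrow> t \<le> T \<Longrightarrow> norm (g0 t) \<le> q"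
    unfolding bounded_pos by auto
  define p where "p = onorm P"
  have p: "0 \<le> p" unfolding p_def by (rule onorm_P_nonneg)
  \<comment> \<open>Chosen to dominate \<open>V (x 0)\<close>, the history, and \<open>lam\<close>;
    the last makes \<open>M\<^sup>2\<close> at least 1 along the barrier.\<close>
  define E0 where "E0 = (p + lam) * (1 + H\<^sup>2)"
  have E0: "lam \<le> E0" "p * H\<^sup>2 \<le> E0" "lam * H\<^sup>2 \<le> E0"
    using p lam_pos by (auto simp: E0_def algebra_simps)
  \<comment> \<open>As in the uniqueness proof, plus \<open>p + p * q\<^sup>2\<close> for the
    forcing term: \<open>2 * M * q \<le> M\<^sup>2 + q\<^sup>2\<close>, and \<open>q\<^sup>2\<close>
    is absorbed into \<open>q\<^sup>2 * M\<^sup>2\<close>.\<close>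
  define L where "L = (2 * c + 2 * p * k1 + p + p * q\<^sup>2 + 1) / lam"
  have L0: "0 \<le> L" and Llam: "L * lam = 2 * c + 2 * p * k1 + p + p * q\<^sup>2 + 1"
    using c_nonneg p k1 lam_pos by (auto simp: L_def)
  \<comment> \<open>The radius that coercivity allows at the barrier's final height, at time
    \<open>T\<close>.\<close>
  define R where "R = sqrt (E0 * exp (L * T) / lam)"
  have R: "0 \<le> R" "lam * R\<^sup>2 = E0 * exp (L * T)"
    using E0 lam_pos by (auto simp: R_def)
  have le_R: "norm u \<le> R" if "lam * (norm u)\<^sup>2 \<le> E0 * exp (L * t)" "t \<le> T" for u :: 'v and t
  proof -
    have "E0 * exp (L * t) \<le> E0 * exp (L * T)"
      using that(2) E0(1) lam_pos L0 by (intro mult_left_mono) (auto intro: mult_left_mono)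
    then have "lam * (norm u)\<^sup>2 \<le> lam * R\<^sup>2" using that(1) R(2) by simp
    then show ?thesis using lam_pos R(1) by (simp add: power2_le_iff_abs_le)
  qed
  obtain x where x: "continuous_on UNIV x" "bounded (range x)" "\<And>s. s \<le> 0 \<Longrightarrow> x s = \<phi> s"
    and dx: "\<And>t. 0 \<le> t \<Longrightarrow> t < T \<Longrightarrow>
      (x has_vector_derivative (F t (closest_point (cball 0 R) (x t)) + G t x)) (at_right t)"
    using truncated_solution[OF hist T R(1)] by blast
  have sub: "continuous_on S x" "bounded (x ` S)" for S
    using x by (auto intro: continuous_on_subset bounded_subset)
  have V_x: "V (x t) \<le> E0 * exp (L * t)" if t: "0 \<le> t" "t \<le> T" for t
  proof (rule growth_bound[of T x])
    show "V (x 0) \<le> E0"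
    proof -
      have "V (x 0) \<le> p * (norm (x 0))\<^sup>2" unfolding p_def by (rule V_upper)
      also have "\<dots> \<le> p * H\<^sup>2" using H[of 0] x(3)[of 0] p by (intro mult_left_mono power_mono) auto
      finally show ?thesis using E0 by simp
    qed
    show "lam * (norm (x s))\<^sup>2 \<le> E0" if "s \<le> 0" for s
    proof -
      have "lam * (norm (x s))\<^sup>2 \<le> lam * H\<^sup>2"
        using H[of s] x(3)[of s] lam_pos that by (intro mult_left_mono power_mono) auto
      then show ?thesis using E0 by simp
    qed
  next
    fix r M assume r: "0 \<le> r" "r < T" and M: "0 \<le> M" "lam * M\<^sup>2 = E0 * exp (L * r)"
      and bnd: "\<And>s. s \<le> r \<Longrightarrow> norm (x s) \<le> M"
    have "lam * 1 \<le> E0 * exp (L * r)"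
      using E0(1) lam_pos L0 r by (intro mult_mono) auto
    then have M1: "1 \<le> M\<^sup>2" using M(2) lam_pos by (metis mult_le_cancel_left_pos)
    have "lam * (norm (x r))\<^sup>2 \<le> E0 * exp (L * r)"
      using bnd[of r] lam_pos unfolding M(2)[symmetric] by (intro mult_left_mono power_mono) auto
    then have xR: "closest_point (cball 0 R) (x r) = x r"
      using le_R[of "x r" r] r by (intro closest_point_self) auto
    define d' where "d' = F r (x r) + G r x"
    have G: "norm (G r x - G r (\<lambda>_. 0)) \<le> k1 * M"
    proof -
      have "norm (G r x - G r (\<lambda>_. 0)) \<le> k r * M"
        using r bnd by (intro G_lip sub) (auto simp: image_constant_conv)
      also have "\<dots> \<le> k1 * M" using k1 r M by (intro mult_right_mono) auto
      finally show ?thesis .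
    qed
    have "d' = (F r (x r) - F r 0) + g0 r + (G r x - G r (\<lambda>_. 0))"
      by (simp add: d'_def g0_def)
    then have "x r \<bullet> P d' = x r \<bullet> P (F r (x r) - F r 0) + x r \<bullet> P (g0 r) + x r \<bullet> P (G r x - G r (\<lambda>_. 0))"
      by (simp only: linear_add[OF bounded_linear.linear[OF P_linear]] inner_add_right)
    also have "\<dots> \<le> c * (norm (x r))\<^sup>2 + p * norm (x r) * norm (g0 r)
        + p * norm (x r) * norm (G r x - G r (\<lambda>_. 0))"
      unfolding p_def using F_one_sided[of r "x r" 0] r by (intro add_mono P_bound) auto
    also have "\<dots> \<le> c * M\<^sup>2 + p * M * q + p * M * (k1 * M)"
      using bnd[of r] M(1) G c_nonneg p k1 q(2)[of r] r
      by (intro add_mono mult_mono power_mono mult_nonneg_nonneg) auto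
    finally have "2 * (x r \<bullet> P d') \<le> (2 * c + 2 * p * k1) * M\<^sup>2 + p * (2 * M * q)"
      by (simp add: power2_eq_square algebra_simps)
    also have "p * (2 * M * q) \<le> p * (M\<^sup>2 + q\<^sup>2)"
      using p by (intro mult_left_mono sum_squares_bound)
    also have "\<dots> \<le> p * (M\<^sup>2 + q\<^sup>2 * M\<^sup>2)"
      using p M1 mult_left_mono[OF M1, of "q\<^sup>2"] by (intro mult_left_mono) auto
    also have "(2 * c + 2 * p * k1) * M\<^sup>2 + p * (M\<^sup>2 + q\<^sup>2 * M\<^sup>2) < L * lam * M\<^sup>2"
      using M1 by (auto simp: Llam algebra_simps)
    finally have "2 * (x r \<bullet> P d') < L * (lam * M\<^sup>2)" by (simp add: ac_simps)
    moreover have "(x has_vector_derivative d') (at_right r)"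
      using dx[OF r] by (simp add: xR d'_def)
    ultimately show "\<exists>d'. (x has_vector_derivative d') (at_right r) \<and>
        2 * (x r \<bullet> P d') < L * (lam * M\<^sup>2)" by blast
  qed (use E0(1) lam_pos L0 t sub in auto)
  show thesis
  proof (rule that[OF x])
    fix t assume t: "0 \<le> t" "t < T"
    have "norm (x t) \<le> R"
      using V_x[of t] P_coercive[of "x t"] t by (intro le_R[of _ t]) (auto simp: V_def)
    then have "closest_point (cball 0 R) (x t) = x t"
      by (intro closest_point_self) auto
    then show "(x has_vector_derivative (F t (x t) + G t x)) (at_right t)"
      using dx[OF t] by simp
  qed
qed

text \<open>Uniqueness makes the solutions on the intervals \<open>[0, n + 1)\<close> agree on
  overlaps, so they glue to one function on the line.\<close>

theorem global_solution:
  assumes hist: "continuous_on {..0} \<phi>" "bounded (\<phi> ` {..0})"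
  obtains x where "continuous_on UNIV x" "\<And>t. bounded (x ` {..t})" "\<And>s. s \<le> 0 \<Longrightarrow> x s = \<phi> s"
    "\<And>t. 0 \<le> t \<Longrightarrow> (x has_vector_derivative (F t (x t) + G t x)) (at_right t)"
proof -
  define sol where "sol n x \<longleftrightarrow> continuous_on UNIV x \<and> bounded (range x) \<and> (\<forall>s\<le>0. x s = \<phi> s) \<and>
    (\<forall>t. 0 \<le> t \<longrightarrow> t < real (Suc n) \<longrightarrow>
      (x has_vector_derivative (F t (x t) + G t x)) (at_right t))" for n x
  have "\<exists>x. sol n x" for n
    using solution_on_interval[OF hist, of "real (Suc n)"]
    unfolding sol_def by (metis of_nat_0_less_iff zero_less_Suc)
  then obtain X where solX: "\<And>n. sol n (X n)" by metis
  have X: "continuous_on UNIV (X n)" "bounded (range (X n))" "s \<le> 0 \<Longrightarrow> X n s = \<phi> s"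
    and dX: "0 \<le> t \<Longrightarrow> t < real (Suc n) \<Longrightarrow>
      (X n has_vector_derivative (F t (X n t) + G t (X n))) (at_right t)" for n s t
    using solX[of n] by (simp_all add: sol_def)
  have sub: "continuous_on S (X n)" "bounded (X n ` S)" for n S
    using X(1,2)[of n] by (auto intro: continuous_on_subset bounded_subset)
  have agree: "X n t = X m t" if "t \<le> real (Suc n)" "t \<le> real (Suc m)" for n m t
    by (rule solutions_agree[of "min (real (Suc n)) (real (Suc m))"])
      (use that in \<open>auto simp: X(3) intro: sub dX\<close>)
  \<comment> \<open>The solution with index \<open>n\<close> is valid up to \<open>n + 1\<close>, so
    the one chosen here is valid strictly beyond \<open>t\<close>; this room yields continuity and
    the right derivative at \<open>t\<close>.\<close>
  define x where "x t = X (nat \<lceil>t\<rceil>) t" for t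
  have xX: "x t = X n t" if "t \<le> real (Suc n)" for t n
    unfolding x_def using that by (intro agree) linarith+
  have near: "\<forall>\<^sub>F s in nhds t. x s = X n s" if "t < real (Suc n)" for t n
    using order_tendstoD(2)[OF filterlim_ident that] by eventually_elim (simp add: xX)
  have x_cont: "continuous_on UNIV x"
  proof (intro continuous_at_imp_continuous_on ballI)
    fix t
    have "t < real (Suc (nat \<lceil>t\<rceil>))" by linarith
    from isCont_cong[OF near[OF this]] X(1)[of "nat \<lceil>t\<rceil>"] show "isCont x t"
      by (simp add: continuous_on_eq_continuous_at)
  qed
  have x_bdd: "bounded (x ` {..t})" for t
  proof -
    have "x ` {..t} = X (nat \<lceil>t\<rceil>) ` {..t}"
      by (intro image_cong refl xX) (auto, linarith)
    then show ?thesis by (simp add: sub)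
  qed
  show thesis
  proof (rule that[OF x_cont x_bdd])
    show "x s = \<phi> s" if "s \<le> 0" for s using that by (simp add: x_def X(3))
    fix t :: real assume t: "0 \<le> t"
    define n where "n = nat \<lceil>t\<rceil>"
    have tn: "t < real (Suc n)" unfolding n_def by linarith
    \<comment> \<open>Causality: the two histories coincide up to \<open>t\<close>, so
      \<open>G_lip\<close> applies with \<open>D = 0\<close>.\<close>
    have "norm (G t x - G t (X n)) \<le> k t * 0"
      using t tn by (intro G_lip sub x_bdd continuous_on_subset[OF x_cont]) (auto simp: xX)
    then have G: "G t x = G t (X n)" by simp
    have "(X n has_vector_derivative (F t (x t) + G t x)) (at_right t)"
      using dX[OF t tn] xX[of t n] tn by (simp add: G)
    moreover have "\<forall>\<^sub>F s in nhds t. s \<in> {t<..} \<longrightarrow> x s = X n s"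
      using near[OF tn] by eventually_elim simp
    ultimately show "(x has_vector_derivative (F t (x t) + G t x)) (at_right t)"
      using has_vector_derivative_cong_ev[of "{t<..}" x "X n" t] xX[of t n] tn by simp
  qed
qed

end

section \<open>Integration against finite signed measures\<close>

lemma sets_upper_variation [measurable_cong]: "sets (upper_variation M K) = sets M"
  by (simp add: upper_variation_def)

lemma space_upper_variation: "space (upper_variation M K) = space M"
  by (simp add: upper_variation_def)

text \<open>
  If the set function in \<^const>\<open>upper_variation\<close> were not countably additive,
  \<^const>\<open>measure_of\<close> would return the null measure; so finiteness needs no Jordan decomposition.
\<close>

lemma finite_measure_upper_variation:
  assumes "total_variation M K < \<infinity>"
  shows "finite_measure (upper_variation M K)"
proof (rule finite_measureI)
  have "ennreal (K B) \<le> total_variation M K" if "B \<in> sets M" for B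
  proof -
    have "ennreal (K B) \<le> (\<Sum>A\<in>{B}. ennreal \<bar>K A\<bar>)" by (simp add: ennreal_leI)
    also have "\<dots> \<le> total_variation M K"
      unfolding total_variation_def using that by (intro SUP_upper) auto
    finally show ?thesis .
  qed
  then have "(SUP B \<in> {B \<in> sets M. B \<subseteq> space M}. ennreal (K B)) \<le> total_variation M K"
    by (intro SUP_least) auto
  then have "emeasure (upper_variation M K) (space M) \<le> total_variation M K"
    unfolding upper_variation_def emeasure_measure_of_conv by auto
  then show "emeasure (upper_variation M K) (space (upper_variation M K)) \<noteq> \<infinity>"
    using assms by (auto simp: space_upper_variation top_unique)
qed

lemma total_variation_minus: "total_variation M (\<lambda>A. - K A) = total_variation M K"
  by (simp add: total_variation_def)

definition variation_mass :: "'a measure \<Rightarrow> ('a set \<Rightarrow> real) \<Rightarrow> real" where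
  "variation_mass M K = measure (upper_variation M K) (space M) + measure (lower_variation M K) (space M)"

text \<open>Both variations are finite measures, so bounded measurable functions are integrable and
  the pointwise bound \<open>D\<close> integrates to \<open>D\<close> times the mass of
  each.\<close>

lemma signed_integral_diff_bound:
  fixes h h' :: "'a \<Rightarrow> 'b::{banach, second_countable_topology}"
  assumes K: "total_variation M K < \<infinity>"
    and h: "h \<in> borel_measurable M" "\<And>s. s \<in> space M \<Longrightarrow> norm (h s) \<le> B"
    and h': "h' \<in> borel_measurable M" "\<And>s. s \<in> space M \<Longrightarrow> norm (h' s) \<le> B'"
    and D: "\<And>s. s \<in> space M \<Longrightarrow> norm (h s - h' s) \<le> D"
  shows "norm (signed_integral M K h - signed_integral M K h') \<le> D * variation_mass M K"
proof -
  \<comment> \<open>Proved for arbitrary \<open>J\<close> because the lower variation of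
    \<open>K\<close> is the upper variation of its negative.\<close>
  have part: "norm ((LINT s|upper_variation M J. h s) - (LINT s|upper_variation M J. h' s))
      \<le> D * measure (upper_variation M J) (space M)"
    if J: "total_variation M J < \<infinity>" for J
  proof -
    let ?U = "upper_variation M J"
    interpret finite_measure ?U by (rule finite_measure_upper_variation[OF J])
    have int: "integrable ?U u"
      if "u \<in> borel_measurable M" "\<And>s. s \<in> space M \<Longrightarrow> norm (u s) \<le> b" for u :: "'a \<Rightarrow> 'b" and b
      by (rule integrable_const_bound[of _ b])
        (use that in \<open>auto simp: space_upper_variation measurable_cong_sets[OF sets_upper_variation refl]\<close>)
    note int = int[OF h] int[OF h']
    have "norm ((LINT s|?U. h s) - (LINT s|?U. h' s)) = norm (LINT s|?U. h s - h' s)"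
      using int by simp
    also have "\<dots> \<le> (LINT s|?U. norm (h s - h' s))" by (rule integral_norm_bound)
    also have "\<dots> \<le> (LINT s|?U. D)"
      using int D by (intro integral_mono) (auto simp: space_upper_variation)
    finally show ?thesis by (simp add: space_upper_variation mult.commute)
  qed
  have "signed_integral M K h - signed_integral M K h' =
     ((LINT s|upper_variation M K. h s) - (LINT s|upper_variation M K. h' s)) -
     ((LINT s|lower_variation M K. h s) - (LINT s|lower_variation M K. h' s))"
    by (simp add: signed_integral_def)
  then show ?thesis
    using part[OF K] part[of "\<lambda>A. - K A"] K
    by (simp add: variation_mass_def lower_variation_def total_variation_minus distrib_left)
      (smt (verit) norm_triangle_ineq4)
qed

text \<open>Dominated convergence for each variation, with a constant as dominating function,
  integrable because the measures are finite.\<close>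

lemma signed_integral_tendsto:
  fixes h :: "nat \<Rightarrow> 'a \<Rightarrow> 'b::{banach, second_countable_topology}"
  assumes K: "total_variation M K < \<infinity>"
    and h: "\<And>n. h n \<in> borel_measurable M" "\<And>n s. s \<in> space M \<Longrightarrow> norm (h n s) \<le> B"
    and h': "h' \<in> borel_measurable M" "\<And>s. s \<in> space M \<Longrightarrow> (\<lambda>n. h n s) \<longlonglongrightarrow> h' s"
  shows "(\<lambda>n. signed_integral M K (h n)) \<longlonglongrightarrow> signed_integral M K h'"
proof -
  have part: "(\<lambda>n. LINT s|upper_variation M J. h n s) \<longlonglongrightarrow> (LINT s|upper_variation M J. h' s)"
    if J: "total_variation M J < \<infinity>" for J
  proof -
    interpret finite_measure "upper_variation M J" by (rule finite_measure_upper_variation[OF J])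
    show ?thesis
      by (rule integral_dominated_convergence[where w = "\<lambda>_. B"])
        (use h h' in \<open>auto simp: space_upper_variation measurable_cong_sets[OF sets_upper_variation refl]\<close>)
  qed
  show ?thesis
    unfolding signed_integral_def lower_variation_def
    using K by (intro tendsto_diff part) (simp_all add: total_variation_minus)
qed

section \<open>Stacked vectors and positive definite matrices\<close>

lemma has_vector_derivative_vec_nth:
  "(x has_vector_derivative x') F \<Longrightarrow> ((\<lambda>s. x s $ i) has_vector_derivative x' $ i) F"
  by (rule bounded_linear.has_vector_derivative[OF bounded_linear_vec_nth])

lemma has_vector_derivative_vecI:
  fixes x :: "real \<Rightarrow> 'a::real_normed_vector^'m"
  assumes "\<And>i. ((\<lambda>s. x s $ i) has_vector_derivative x' $ i) (at t within S)"
  shows "(x has_vector_derivative x') (at t within S)"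
proof -
  have "((\<lambda>y. (1 / norm (y - t)) *\<^sub>R (x y - (x t + (y - t) *\<^sub>R x'))) \<longlongrightarrow> 0) (at t within S)"
    using assms by (intro vec_tendstoI) (simp add: has_vector_derivative_def has_derivative_within)
  then show ?thesis
    by (simp add: has_vector_derivative_def has_derivative_within bounded_linear_scaleR_left)
qed

text \<open>The quadratic form attains a minimum on the compact unit sphere, and it is positive
  there; homogeneity extends the bound to all vectors.\<close>

lemma symmetric_positive_definite_coercive:
  fixes P :: "real^'n^'n"
  assumes "symmetric_positive_definite P"
  obtains lam where "0 < lam" "\<And>u. lam * (norm u)\<^sup>2 \<le> u \<bullet> (P *v u)"
proof -
  let ?S = "sphere (0 :: real^'n) 1"
  have ne: "?S \<noteq> {}" by simp
  have "continuous_on ?S (\<lambda>u. u \<bullet> (P *v u))"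
    by (intro continuous_intros linear_continuous_on) auto
  with ne obtain v where v: "v \<in> ?S" "\<And>u. u \<in> ?S \<Longrightarrow> v \<bullet> (P *v v) \<le> u \<bullet> (P *v u)"
    using continuous_attains_inf[of ?S "\<lambda>u. u \<bullet> (P *v u)"] by auto
  show thesis
  proof (rule that[of "v \<bullet> (P *v v)"])
    show "0 < v \<bullet> (P *v v)"
    proof -
      have "v \<noteq> 0" using v(1) by auto
      then show ?thesis using assms by (simp add: symmetric_positive_definite_def)
    qed
    show "v \<bullet> (P *v v) * (norm u)\<^sup>2 \<le> u \<bullet> (P *v u)" for u
    proof (cases "u = 0")
      case False
      have "v \<bullet> (P *v v) \<le> (u /\<^sub>R norm u) \<bullet> (P *v (u /\<^sub>R norm u))"
        using False by (intro v(2)) simp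
      also have "\<dots> = (u \<bullet> (P *v u)) / (norm u)\<^sup>2"
        by (simp add: linear_cmul[OF matrix_vector_mul_linear] power2_eq_square divide_inverse ac_simps)
      finally show ?thesis using False by (simp add: field_simps)
    qed simp
  qed
qed

lemma norm_vec_le_sum:
  fixes v :: "'a::real_normed_vector^'m"
  shows "norm v \<le> (\<Sum>i\<in>UNIV. norm (v $ i))"
  by (simp add: norm_vec_def L2_set_le_sum)

lemma norm_vec_power2:
  fixes v :: "'a::real_inner^'m"
  shows "(norm v)\<^sup>2 = (\<Sum>i\<in>UNIV. (norm (v $ i))\<^sup>2)"
  by (simp add: power2_norm_eq_inner inner_vec_def)

section \<open>The distributed delay term: Lipschitz bound and continuity in time\<close>

definition delay_term ::
    "(real \<Rightarrow> real^'n \<Rightarrow> real^'n) \<Rightarrow> (real \<Rightarrow> real^'m^'m) \<Rightarrow>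
     ('m \<Rightarrow> 'm \<Rightarrow> real \<Rightarrow> real) \<Rightarrow> ('m \<Rightarrow> 'm \<Rightarrow> real set \<Rightarrow> real) \<Rightarrow>
     real \<Rightarrow> (real \<Rightarrow> real^'n^'m) \<Rightarrow> real^'n^'m" where
  "delay_term g A \<tau> K t x = (\<chi> i. \<Sum>j\<in>UNIV. A t $ i $ j *\<^sub>R
     signed_integral half_line (K i j) (\<lambda>s. g t (x (t - \<tau> i j t - s) $ j)))"

lemma coupled_rhs_eq:
  "coupled_rhs f g A \<tau> K x i t = ((\<chi> i. f t (x t $ i)) + delay_term g A \<tau> K t x) $ i"
  by (simp add: coupled_rhs_def delay_term_def)

locale delay_data =
  fixes g :: "real \<Rightarrow> real^'n \<Rightarrow> real^'n" and A :: "real \<Rightarrow> real^'m^'m"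
    and \<tau> :: "'m \<Rightarrow> 'm \<Rightarrow> real \<Rightarrow> real" and K :: "'m \<Rightarrow> 'm \<Rightarrow> real set \<Rightarrow> real"
    and \<kappa> :: "real \<Rightarrow> real"
  assumes K_finite: "\<And>i j. total_variation half_line (K i j) < \<infinity>"
    and A_cont: "continuous_on {0..} A"
    and g_cont: "continuous_on ({0..} \<times> UNIV) (\<lambda>(t, u). g t u)"
    and \<kappa>_cont: "continuous_on {0..} \<kappa>" and \<kappa>_nonneg: "\<And>t. 0 \<le> t \<Longrightarrow> 0 \<le> \<kappa> t"
    and g_lip: "\<And>t u v. 0 \<le> t \<Longrightarrow> norm (g t u - g t v) \<le> \<kappa> t * norm (u - v)"
    and \<tau>_cont: "\<And>i j. continuous_on {0..} (\<tau> i j)"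
    and \<tau>_nonneg: "\<And>i j t. 0 \<le> t \<Longrightarrow> 0 \<le> \<tau> i j t"
begin

text \<open>This takes the role of \<open>k\<close> in \<open>fde\<close>. Only \<open>A\<close> and
  \<open>\<kappa>\<close> vary with time, which gives its continuity.\<close>

definition lip :: "real \<Rightarrow> real" where
  "lip t = (\<Sum>i\<in>UNIV. \<Sum>j\<in>UNIV. \<bar>A t $ i $ j\<bar> * (\<kappa> t * variation_mass half_line (K i j)))"

lemma lip_cont: "continuous_on {0..} lip"
  unfolding lip_def by (intro continuous_intros A_cont \<kappa>_cont)

lemma g_bound: "0 \<le> t \<Longrightarrow> norm (g t u) \<le> norm (g t 0) + \<kappa> t * norm u"
  using g_lip[of t u 0] norm_triangle_sub[of "g t u" "g t 0"] by simp

text \<open>Nonnegative delays keep the argument of \<open>x\<close> in \<open>{..t}\<close>, so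
  continuity of \<open>x\<close> up to the present makes the integrand continuous on the half
  line.\<close>

lemma integrand_measurable:
  assumes t: "0 \<le> t" and x: "continuous_on {..t} x"
  shows "(\<lambda>s. g t (x (t - \<tau> i j t - s) $ j)) \<in> borel_measurable half_line"
proof (rule borel_measurable_continuous_on_restrict)
  have "continuous_on {0..} (\<lambda>s. (\<lambda>(t, u). g t u) (t, x (t - \<tau> i j t - s) $ j))"
    by (rule continuous_on_compose2[OF g_cont])
      (use t \<tau>_nonneg[OF t, of i j] in \<open>auto intro!: continuous_intros continuous_on_compose2[OF x]\<close>)
  then show "continuous_on {0..} (\<lambda>s. g t (x (t - \<tau> i j t - s) $ j))" by simp
qed

lemma integrand_bounded:
  assumes t: "0 \<le> t" and x: "bounded (x ` {..t})"
  obtains B where "\<And>i j s. 0 \<le> s \<Longrightarrow> norm (g t (x (t - \<tau> i j t - s) $ j)) \<le> B"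
proof -
  obtain B where B: "\<And>s. s \<le> t \<Longrightarrow> norm (x s) \<le> B"
    using x by (auto simp: bounded_iff)
  show thesis
  proof (rule that)
    fix i j and s :: real assume s: "0 \<le> s"
    have "norm (g t (x (t - \<tau> i j t - s) $ j)) \<le> norm (g t 0) + \<kappa> t * norm (x (t - \<tau> i j t - s) $ j)"
      by (rule g_bound[OF t])
    also have "\<dots> \<le> norm (g t 0) + \<kappa> t * B"
      using B[of "t - \<tau> i j t - s"] s \<tau>_nonneg[OF t, of i j] \<kappa>_nonneg[OF t]
      by (intro add_left_mono mult_left_mono order_trans[OF Finite_Cartesian_Product.norm_nth_le]) auto
    finally show "norm (g t (x (t - \<tau> i j t - s) $ j)) \<le> norm (g t 0) + \<kappa> t * B" .
  qed
qed

text \<open>Each integrand differs by at most \<open>\<kappa> t * D\<close>; integration contributes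
  the variation mass, and the sum of the component norms dominates the Euclidean norm.\<close>

lemma delay_term_lip:
  assumes t: "0 \<le> t"
    and x: "continuous_on {..t} x" "bounded (x ` {..t})"
    and y: "continuous_on {..t} y" "bounded (y ` {..t})"
    and D: "\<And>s. s \<le> t \<Longrightarrow> norm (x s - y s) \<le> D"
  shows "norm (delay_term g A \<tau> K t x - delay_term g A \<tau> K t y) \<le> lip t * D"
proof -
  let ?I = "\<lambda>x i j. signed_integral half_line (K i j) (\<lambda>s. g t (x (t - \<tau> i j t - s) $ j))"
  obtain B where B: "\<And>i j s. 0 \<le> s \<Longrightarrow> norm (g t (x (t - \<tau> i j t - s) $ j)) \<le> B"
    using integrand_bounded[OF t x(2)] by blast
  obtain B' where B': "\<And>i j s. 0 \<le> s \<Longrightarrow> norm (g t (y (t - \<tau> i j t - s) $ j)) \<le> B'"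
    using integrand_bounded[OF t y(2)] by blast
  have I: "norm (?I x i j - ?I y i j) \<le> (\<kappa> t * D) * variation_mass half_line (K i j)" for i j
  proof (rule signed_integral_diff_bound[OF K_finite integrand_measurable[OF t x(1)] _
        integrand_measurable[OF t y(1)]])
    fix s :: real assume s: "s \<in> space half_line"
    then show "norm (g t (x (t - \<tau> i j t - s) $ j)) \<le> B" "norm (g t (y (t - \<tau> i j t - s) $ j)) \<le> B'"
      using B B' by (auto simp: space_restrict_space)
    let ?r = "t - \<tau> i j t - s"
    have "norm (g t (x ?r $ j) - g t (y ?r $ j)) \<le> \<kappa> t * norm (x ?r $ j - y ?r $ j)"
      by (rule g_lip[OF t])
    also have "\<dots> = \<kappa> t * norm ((x ?r - y ?r) $ j)" by simp
    also have "\<dots> \<le> \<kappa> t * D"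
      using s \<tau>_nonneg[OF t, of i j] \<kappa>_nonneg[OF t]
      by (intro mult_left_mono order_trans[OF Finite_Cartesian_Product.norm_nth_le D]) (auto simp: space_restrict_space)
    finally show "norm (g t (x ?r $ j) - g t (y ?r $ j)) \<le> \<kappa> t * D" .
  qed
  have "norm (delay_term g A \<tau> K t x - delay_term g A \<tau> K t y)
      \<le> (\<Sum>i\<in>UNIV. norm ((delay_term g A \<tau> K t x - delay_term g A \<tau> K t y) $ i))"
    by (rule norm_vec_le_sum)
  also have "\<dots> \<le> (\<Sum>i\<in>UNIV. \<Sum>j\<in>UNIV.
      \<bar>A t $ i $ j\<bar> * ((\<kappa> t * D) * variation_mass half_line (K i j)))"
  proof (rule sum_mono)
    fix i
    have eq: "(delay_term g A \<tau> K t x - delay_term g A \<tau> K t y) $ i =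
        (\<Sum>j\<in>UNIV. A t $ i $ j *\<^sub>R (?I x i j - ?I y i j))"
      by (simp add: delay_term_def sum_subtractf scaleR_diff_right)
    show "norm ((delay_term g A \<tau> K t x - delay_term g A \<tau> K t y) $ i) \<le>
      (\<Sum>j\<in>UNIV. \<bar>A t $ i $ j\<bar> * ((\<kappa> t * D) * variation_mass half_line (K i j)))"
      unfolding eq by (intro sum_norm_le) (auto intro!: mult_left_mono I)
  qed
  also have "\<dots> = lip t * D"
    unfolding lip_def sum_distrib_right by (intro sum.cong) (auto simp: ac_simps)
  finally show ?thesis .
qed

text \<open>Along a convergent sequence of times the integrands converge pointwise by joint
  continuity of \<open>g\<close>, and dominated convergence passes to the integrals.\<close>

lemma delay_term_cont:
  assumes x: "continuous_on UNIV x" "bounded (range x)"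
  shows "continuous_on {0..} (\<lambda>t. delay_term g A \<tau> K t x)"
proof -
  obtain B where B: "\<And>s. norm (x s) \<le> B" using x(2) by (auto simp: bounded_iff)
  have g0_cont: "continuous_on {0..} (\<lambda>t. g t 0)"
  proof -
    have "continuous_on {0..} (\<lambda>t. (\<lambda>(t, u). g t u) (t, 0))"
      by (rule continuous_on_compose2[OF g_cont]) (auto intro!: continuous_intros)
    then show ?thesis by simp
  qed
  have "continuous_on {0..} (\<lambda>t. signed_integral half_line (K i j) (\<lambda>s. g t (x (t - \<tau> i j t - s) $ j)))"
    for i j
  proof (rule continuous_on_sequentiallyI)
    fix u :: "nat \<Rightarrow> real" and a
    assume u: "\<forall>n. u n \<in> {0..}" and a: "a \<in> {0..}" and lim: "u \<longlonglongrightarrow> a"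
    \<comment> \<open>The times stay in a compact interval, on which \<open>g t 0\<close> and
      \<open>\<kappa>\<close> are bounded; this gives one dominating constant for the whole
      sequence.\<close>
    from lim have "Bseq u" using convergentI convergent_imp_Bseq by blast
    then obtain T where T: "\<And>n. u n \<le> T" using BseqE abs_le_D1 real_norm_def by metis
    obtain G0 where G0: "\<And>t. 0 \<le> t \<Longrightarrow> t \<le> T \<Longrightarrow> norm (g t 0) \<le> G0"
      using compact_interval_norm_bound[OF g0_cont, of T] by blast
    obtain k1 where k1: "\<And>t. 0 \<le> t \<Longrightarrow> t \<le> T \<Longrightarrow> norm (\<kappa> t) \<le> k1"
      using compact_interval_norm_bound[OF \<kappa>_cont, of T] by blast
    show "(\<lambda>n. signed_integral half_line (K i j) (\<lambda>s. g (u n) (x (u n - \<tau> i j (u n) - s) $ j)))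
      \<longlonglongrightarrow> signed_integral half_line (K i j) (\<lambda>s. g a (x (a - \<tau> i j a - s) $ j))"
    proof (rule signed_integral_tendsto[OF K_finite])
      show "(\<lambda>s. g (u n) (x (u n - \<tau> i j (u n) - s) $ j)) \<in> borel_measurable half_line" for n
        using u by (intro integrand_measurable continuous_on_subset[OF x(1)]) auto
      show "(\<lambda>s. g a (x (a - \<tau> i j a - s) $ j)) \<in> borel_measurable half_line"
        using a by (intro integrand_measurable continuous_on_subset[OF x(1)]) auto
      show "norm (g (u n) (x (u n - \<tau> i j (u n) - s) $ j)) \<le> G0 + k1 * B" for n s
      proof -
        have un: "0 \<le> u n" "u n \<le> T" using u T by auto
        have "norm (g (u n) (x (u n - \<tau> i j (u n) - s) $ j))
          \<le> norm (g (u n) 0) + \<kappa> (u n) * norm (x (u n - \<tau> i j (u n) - s) $ j)"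
          by (rule g_bound[OF un(1)])
        also have "\<dots> \<le> G0 + k1 * B"
          using k1[OF un] \<kappa>_nonneg[OF un(1)] by (intro add_mono G0 un mult_mono order_trans[OF Finite_Cartesian_Product.norm_nth_le B]) auto
        finally show ?thesis .
      qed
      show "(\<lambda>n. g (u n) (x (u n - \<tau> i j (u n) - s) $ j)) \<longlonglongrightarrow> g a (x (a - \<tau> i j a - s) $ j)" for s
      proof -
        have "continuous_on {0..} (\<lambda>t. (\<lambda>(t, u). g t u) (t, x (t - \<tau> i j t - s) $ j))"
          by (rule continuous_on_compose2[OF g_cont])
            (auto intro!: continuous_intros continuous_on_compose2[OF x(1)] \<tau>_cont)
        then have "continuous_on {0..} (\<lambda>t. g t (x (t - \<tau> i j t - s) $ j))" by simp
        from continuous_on_tendsto_compose[OF this lim] show ?thesis using u a by auto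
      qed
    qed
  qed
  then show ?thesis
    unfolding delay_term_def by (intro continuous_intros A_cont)
qed

end

section \<open>The history space\<close>

lemma C_infinityD:
  assumes "x \<in> C_infinity a"
  shows "continuous_on {..a} x" "bounded (x ` {..a})"
  using assms by (auto simp: C_infinity_def bdd_above_def bounded_iff)

lemma C_infinity_vec:
  assumes "\<And>i. (\<lambda>\<theta>. \<phi> \<theta> $ i) \<in> C_infinity a"
  shows "\<phi> \<in> C_infinity a"
proof -
  have cont: "continuous_on {..a} (\<lambda>\<theta>. \<chi> i. \<phi> \<theta> $ i)"
    by (intro continuous_on_vec_lambda C_infinityD assms)
  have "\<forall>i. \<exists>B. \<forall>\<theta>\<le>a. norm (\<phi> \<theta> $ i) \<le> B"
  proof
    fix i
    show "\<exists>B. \<forall>\<theta>\<le>a. norm (\<phi> \<theta> $ i) \<le> B"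
      using C_infinityD(2)[OF assms[of i]] by (simp add: bounded_iff image_iff Ball_def) blast
  qed
  then obtain B where B: "\<And>i \<theta>. \<theta> \<le> a \<Longrightarrow> norm (\<phi> \<theta> $ i) \<le> B i" by metis
  have "norm (\<phi> \<theta>) \<le> (\<Sum>i\<in>UNIV. B i)" if "\<theta> \<le> a" for \<theta>
    using norm_vec_le_sum[of "\<phi> \<theta>"] sum_mono[of UNIV "\<lambda>i. norm (\<phi> \<theta> $ i)" B] B[OF that] by force
  then have bdd: "bdd_above ((\<lambda>\<theta>. norm (\<phi> \<theta>)) ` {..a})" by (auto simp: bdd_above_def)
  have "\<forall>i. \<exists>L. ((\<lambda>\<theta>. \<phi> \<theta> $ i) \<longlongrightarrow> L) at_bot"
    using assms by (auto simp: C_infinity_def)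
  then obtain L where "\<And>i. ((\<lambda>\<theta>. \<phi> \<theta> $ i) \<longlongrightarrow> L i) at_bot" by metis
  then have "(\<phi> \<longlongrightarrow> (\<chi> i. L i)) at_bot" by (intro vec_tendstoI) simp
  with cont bdd show ?thesis by (auto simp: C_infinity_def)
qed

section \<open>The coupled system as an instance of the abstract equation\<close>

theorem theorem1:
  fixes f g :: "real \<Rightarrow> real^'n \<Rightarrow> real^'n"
    and A :: "real \<Rightarrow> real^'m^'m"
    and \<tau> :: "'m \<Rightarrow> 'm \<Rightarrow> real \<Rightarrow> real"
    and K :: "'m \<Rightarrow> 'm \<Rightarrow> real set \<Rightarrow> real"
    and \<phi> :: "real \<Rightarrow> real^'n^'m"
  assumes K: "\<And>i j. signed_measure half_line (K i j)"
    and K_finite: "\<And>i j. total_variation half_line (K i j) < \<infinity>"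
    and A1_cont: "continuous_on ({0..} \<times> UNIV) (\<lambda>(t, u). f t u)"
    and A1_lip: "\<And>W. compact W \<Longrightarrow> W \<subseteq> {0..} \<times> UNIV \<Longrightarrow>
      \<exists>l>0. \<forall>t u\<^sub>1 u\<^sub>2. (t, u\<^sub>1) \<in> W \<longrightarrow> (t, u\<^sub>2) \<in> W \<longrightarrow>
        norm (f t u\<^sub>1 - f t u\<^sub>2) \<le> l * norm (u\<^sub>1 - u\<^sub>2)"
    and A2: "continuous_on {0..} A"
    and A3_cont: "continuous_on ({0..} \<times> UNIV) (\<lambda>(t, u). g t u)"
    and A3_lip: "\<exists>\<kappa> :: real \<Rightarrow> real. continuous_on {0..} \<kappa> \<and> (\<forall>t\<ge>0. 0 \<le> \<kappa> t) \<and>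
      (\<forall>t\<ge>0. \<forall>u\<^sub>1 u\<^sub>2. norm (g t u\<^sub>1 - g t u\<^sub>2) \<le> \<kappa> t * norm (u\<^sub>1 - u\<^sub>2))"
    and A4: "\<And>i j. continuous_on {0..} (\<tau> i j) \<and> (\<forall>t\<ge>0. 0 \<le> \<tau> i j t)"
    and A5: "\<exists>(P :: real^'n^'n) (\<delta> :: real^'n) (\<epsilon> :: real).
      symmetric_positive_definite P \<and> \<epsilon> > 0 \<and>
      (\<forall>u\<^sub>1 u\<^sub>2. \<forall>t\<ge>0.
        (u\<^sub>1 - u\<^sub>2) \<bullet> (P *v ((f t u\<^sub>1 - f t u\<^sub>2) - diag_matrix \<delta> *v (u\<^sub>1 - u\<^sub>2)))
          \<le> - \<epsilon> * ((u\<^sub>1 - u\<^sub>2) \<bullet> (u\<^sub>1 - u\<^sub>2)))"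
    and \<phi>: "\<And>i. (\<lambda>\<theta>. \<phi> \<theta> $ i) \<in> C_infinity 0"
  shows "(\<exists>!(B, x). noncontinuable_solution f g A \<tau> K \<phi> B x) \<and>
    (\<forall>B x. noncontinuable_solution f g A \<tau> K \<phi> B x \<longrightarrow> time_interval B = {0..})"
proof -
  obtain \<kappa> where \<kappa>: "continuous_on {0..} \<kappa>" "\<forall>t\<ge>0. 0 \<le> \<kappa> t"
    "\<forall>t\<ge>0. \<forall>u v. norm (g t u - g t v) \<le> \<kappa> t * norm (u - v)"
    using A3_lip by (elim exE conjE)
  interpret dd: delay_data g A \<tau> K \<kappa>
    using K_finite A2 A3_cont \<kappa> A4 by unfold_locales auto
  obtain P :: "real^'n^'n" and \<delta> :: "real^'n" and \<epsilon> where P: "symmetric_positive_definite P"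
    and \<epsilon>: "\<epsilon> > 0" and diss: "\<forall>u v. \<forall>t\<ge>0.
      (u - v) \<bullet> (P *v ((f t u - f t v) - diag_matrix \<delta> *v (u - v))) \<le> - \<epsilon> * ((u - v) \<bullet> (u - v))"
    using A5 by (elim exE conjE)
  obtain lam where lam: "0 < lam" "\<And>u. lam * (norm u)\<^sup>2 \<le> u \<bullet> (P *v u)"
    using symmetric_positive_definite_coercive[OF P] by blast
  have P_sym: "u \<bullet> (P *v v) = (P *v u) \<bullet> v" for u v
    using P by (metis dot_lmul_matrix symmetric_positive_definite_def vector_transpose_matrix)
  let ?PD = "\<lambda>u. P *v (diag_matrix \<delta> *v u)"
  have PD: "bounded_linear ?PD"
    by (rule bounded_linear_compose[of "(*v) P" "(*v) (diag_matrix \<delta>)"]) auto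
  \<comment> \<open>Moving the \<open>\<delta>\<close> term of the dissipativity condition to the
    right costs at most this operator norm, and the remaining \<open>\<epsilon>\<close> term has a
    favourable sign. The entries of \<open>\<delta>\<close> may have any sign, while
    \<open>c\<close> is nonnegative.\<close>
  define c where "c = onorm ?PD"
  have one_sided: "(u - v) \<bullet> (P *v (f t u - f t v)) \<le> c * (norm (u - v))\<^sup>2" if "0 \<le> t" for t u v
  proof -
    have "(u - v) \<bullet> (P *v (f t u - f t v)) =
      (u - v) \<bullet> (P *v ((f t u - f t v) - diag_matrix \<delta> *v (u - v))) + (u - v) \<bullet> ?PD (u - v)"
      by (simp add: matrix_vector_mult_diff_distrib inner_diff_right)
    also have "\<dots> \<le> 0 + norm (u - v) * (c * norm (u - v))"
    proof (rule add_mono)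
      have "0 \<le> \<epsilon> * ((u - v) \<bullet> (u - v))" using \<epsilon> by simp
      then show "(u - v) \<bullet> (P *v ((f t u - f t v) - diag_matrix \<delta> *v (u - v))) \<le> 0"
        using diss[rule_format, OF that, of u v] by linarith
      show "(u - v) \<bullet> ?PD (u - v) \<le> norm (u - v) * (c * norm (u - v))"
        unfolding c_def
        by (intro order_trans[OF norm_cauchy_schwarz] mult_left_mono onorm PD) simp
    qed
    finally show ?thesis by (simp add: power2_eq_square ac_simps)
  qed
  define F :: "real \<Rightarrow> real^'n^'m \<Rightarrow> real^'n^'m" where "F t v = (\<chi> i. f t (v $ i))" for t v
  define G where "G = delay_term g A \<tau> K"
  \<comment> \<open>The block-diagonal copy of \<open>P\<close>: symmetry, coercivity and the
    one-sided bound carry over with the same constants by summing over blocks.\<close>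
  define Q :: "real^'n^'m \<Rightarrow> real^'n^'m" where "Q v = (\<chi> i. P *v (v $ i))" for v
  interpret fde F G dd.lip Q lam c
  proof (rule fde.intro)
    have "continuous_on ({0..} \<times> UNIV) (\<lambda>p. (\<lambda>(t, u). f t u) (fst p, snd p $ i))" for i :: 'm
      by (rule continuous_on_compose2[OF A1_cont]) (auto intro!: continuous_intros)
    then show "continuous_on ({0..} \<times> UNIV) (\<lambda>(t, u). F t u)"
      by (auto simp: F_def split_def intro!: continuous_on_vec_lambda)
    show "\<exists>l\<ge>0. \<forall>t\<in>{0..T}. \<forall>u\<in>cball 0 R. \<forall>v\<in>cball 0 R. norm (F t u - F t v) \<le> l * norm (u - v)"
      for T R
    proof -
      \<comment> \<open>Every block of a vector in the big ball lies in the ball of the same radius,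
        so the constant for this one compact cylinder serves all blocks.\<close>
      have "compact ({0..T} \<times> cball (0 :: real^'n) R)" "{0..T} \<times> cball (0 :: real^'n) R \<subseteq> {0..} \<times> UNIV"
        by (auto intro: compact_Times)
      from A1_lip[OF this] obtain l where l: "l > 0" "\<And>t u v. t \<in> {0..T} \<Longrightarrow>
          u \<in> cball 0 R \<Longrightarrow> v \<in> cball 0 R \<Longrightarrow> norm (f t u - f t v) \<le> l * norm (u - v)"
        by (metis mem_Sigma_iff)
      have "norm (F t u - F t v) \<le> norm (l *\<^sub>R (u - v))"
        if t: "t \<in> {0..T}" and uv: "u \<in> cball 0 R" "v \<in> cball 0 R" for t u v
      proof (rule norm_le_componentwise_cart)
        fix i
        have "u $ i \<in> cball 0 R" "v $ i \<in> cball 0 R"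
          using uv Finite_Cartesian_Product.norm_nth_le[of u i] Finite_Cartesian_Product.norm_nth_le[of v i] by auto
        from l(2)[OF t this] show "norm ((F t u - F t v) $ i) \<le> norm ((l *\<^sub>R (u - v)) $ i)"
          using l(1) by (simp add: F_def)
      qed
      then show ?thesis using l(1) by (intro exI[of _ l]) auto
    qed
    show "(u - v) \<bullet> Q (F t u - F t v) \<le> c * (norm (u - v))\<^sup>2" if "0 \<le> t" for t u v
    proof -
      have "(u - v) \<bullet> Q (F t u - F t v)
        = (\<Sum>i\<in>UNIV. (u $ i - v $ i) \<bullet> (P *v (f t (u $ i) - f t (v $ i))))"
        by (simp add: inner_vec_def Q_def F_def)
      also have "\<dots> \<le> (\<Sum>i\<in>UNIV. c * (norm (u $ i - v $ i))\<^sup>2)"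
        by (intro sum_mono one_sided that)
      also have "\<dots> = c * (norm (u - v))\<^sup>2"
        by (simp add: norm_vec_power2 sum_distrib_left)
      finally show ?thesis .
    qed
    have "linear Q"
      by (rule linearI) (simp_all add: Q_def vec_eq_iff matrix_vector_right_distrib
          linear_cmul[OF matrix_vector_mul_linear])
    then show "bounded_linear Q" by (simp add: linear_conv_bounded_linear)
    show "u \<bullet> Q v = Q u \<bullet> v" for u v
      unfolding inner_vec_def[of u] inner_vec_def[of "Q u"] by (simp add: Q_def P_sym)
    show "lam * (norm u)\<^sup>2 \<le> u \<bullet> Q u" for u
    proof -
      have "u \<bullet> Q u = (\<Sum>i\<in>UNIV. u $ i \<bullet> (P *v (u $ i)))"
        by (simp only: inner_vec_def[of u] Q_def vec_lambda_beta)
      then show ?thesis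
        unfolding norm_vec_power2[of u] sum_distrib_left by (simp only: sum_mono lam(2))
    qed
    show "0 \<le> c" unfolding c_def by (rule onorm_pos_le[OF PD])
  qed (auto simp: G_def intro: dd.delay_term_lip dd.delay_term_cont dd.lip_cont lam(1))
  have sol_der: "(\<forall>i. ((\<lambda>s. x s $ i) has_vector_derivative coupled_rhs f g A \<tau> K x i t) (at_right t))
      \<longleftrightarrow> (x has_vector_derivative (F t (x t) + G t x)) (at_right t)" for x t
    unfolding coupled_rhs_eq F_def G_def
    by (blast intro: has_vector_derivative_vec_nth has_vector_derivative_vecI)
  have \<phi>C: "\<phi> \<in> C_infinity 0" by (rule C_infinity_vec[OF \<phi>])
  obtain x where x: "continuous_on UNIV x" "\<And>t. bounded (x ` {..t})" "\<And>s. s \<le> 0 \<Longrightarrow> x s = \<phi> s"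
    and dx: "\<And>t. 0 \<le> t \<Longrightarrow> (x has_vector_derivative (F t (x t) + G t x)) (at_right t)"
    using global_solution[OF C_infinityD[OF \<phi>C]] by blast
  have ti: "time_interval \<infinity> = {0..}" by (auto simp: time_interval_def)
  have sol: "is_solution f g A \<tau> K \<phi> \<infinity> x"
    unfolding is_solution_def
  proof (intro conjI allI impI ballI)
    show "x \<in> C_infinity a" for a
    proof -
      obtain L where "(\<phi> \<longlongrightarrow> L) at_bot" using \<phi>C by (auto simp: C_infinity_def)
      moreover have "\<forall>\<^sub>F s in at_bot. x s = \<phi> s"
        using eventually_le_at_bot[of "0 :: real"] by eventually_elim (simp add: x(3))
      ultimately have "(x \<longlongrightarrow> L) at_bot" by (simp add: filterlim_cong)
      moreover have "bdd_above ((\<lambda>\<theta>. norm (x \<theta>)) ` {..a})"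
        using x(2)[of a] by (auto simp: bounded_iff bdd_above_def)
      ultimately show ?thesis
        using continuous_on_subset[OF x(1), of "{..a}"] by (auto simp: C_infinity_def)
    qed
    show "((\<lambda>s. x s $ i) has_vector_derivative coupled_rhs f g A \<tau> K x i t) (at_right t)"
      if "t \<in> time_interval \<infinity>" for t i
      using sol_der[of x t] dx[of t] that by (auto simp: ti)
  qed (auto simp: x(3) extensional_def)
  \<comment> \<open>Uniqueness is applied on \<open>{..t}\<close> with \<open>t\<close> below the
    end of the interval of existence, where membership in \<open>C_infinity t\<close> supplies
    boundedness.\<close>
  have agree: "y t = x t" if y: "is_solution f g A \<tau> K \<phi> B y" and t: "ereal t < B" for B y t
  proof (rule solutions_agree[of t y x])
    have "y \<in> C_infinity t" using y t by (auto simp: is_solution_def)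
    then show "continuous_on {..t} y" "bounded (y ` {..t})" by (rule C_infinityD)+
    show "y s = x s" if "s \<le> 0" for s using y that x(3) by (auto simp: is_solution_def)
    show "(y has_vector_derivative (F r (y r) + G r y)) (at_right r)" if r: "0 \<le> r" "r < t" for r
    proof -
      have "r \<in> time_interval B" using r t by (cases B) (auto simp: time_interval_def)
      then show ?thesis using y sol_der[of y r] unfolding is_solution_def by blast
    qed
  qed (use continuous_on_subset[OF x(1)] x(2) dx in auto)
  \<comment> \<open>No time interval properly contains the half line.\<close>
  have "noncontinuable_solution f g A \<tau> K \<phi> \<infinity> x"
    using sol unfolding noncontinuable_solution_def is_continuation_def
    by (auto simp: ti) (auto simp: time_interval_def)
  moreover have unique: "B = \<infinity> \<and> y = x" if nc: "noncontinuable_solution f g A \<tau> K \<phi> B y" for B y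
  proof -
    have y: "is_solution f g A \<tau> K \<phi> B y" using nc by (simp add: noncontinuable_solution_def)
    \<comment> \<open>If \<open>B\<close> were finite, \<open>x\<close> itself would continue
      \<open>y\<close>. Once \<open>B\<close> is infinite, the domain is the whole line and
      agreement there is equality of functions.\<close>
    have B: "B = \<infinity>"
    proof (rule ccontr)
      assume "B \<noteq> \<infinity>"
      moreover have "0 < B" using y by (simp add: is_solution_def)
      ultimately obtain b where b: "B = ereal b" "0 < b" by (cases B) auto
      then have "b \<in> {0..} - time_interval B" by (simp add: time_interval_def)
      then have "time_interval B \<subset> time_interval \<infinity>"
        unfolding ti by (auto simp: time_interval_def)
      moreover have "\<forall>t\<in>time_interval B. y t = x t"
        using agree[OF y] by (auto simp: time_interval_def)
      ultimately have "is_continuation f g A \<tau> K \<phi> B y \<infinity> x"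
        using y sol by (simp add: is_continuation_def)
      then show False using nc by (auto simp: noncontinuable_solution_def)
    qed
    then show ?thesis using agree[OF y] by auto
  qed
  ultimately show ?thesis using ti by blast
qed

end
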